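(* Let $\mathbb{K}$ be an algebraically closed field of characteristic zero, $\mathcal{C}\subset\mathbb{K}^2$ an affine irreducible plane curve, $A=(a,b)\in\mathbb{K}^2$, $d\in\mathbb{K}\setminus\{0\}$, and assume that $\mathcal{C}_0\neq\emptyset$ and that $\mathcal{C}$ is not a circle centered at $A$. Then an irreducible component $\mathcal{M}$ of $\mathfrak{C}(\mathcal{C},A,d)$ is special if and only if $\mathfrak{C}(\mathcal{M},A,d)=\mathcal{C}$.
   Context: For an irreducible plane curve $\mathcal{D}$ defined by an irreducible polynomial $g(y_1,y_2)$, and $\delta\in\mathbb{K}\setminus\{0\}$: $\mathfrak{B}(\mathcal{D},A,\delta)\subset\mathbb{K}^2\times\mathbb{K}^2\times\mathbb{K}$ is the set of $(\bar x,\bar y,w)$ with $g(y_1,y_2)=0$, $(x_1-y_1)^2+(x_2-y_2)^2=\delta^2$, $(y_2-b)(x_1-y_1)-(y_1-a)(x_2-y_2)=0$, $w((y_1-a)^2+(y_2-b)^2)=1$; $\pi_1,\pi_2$ denote the projections $(\bar x,\bar y,w)\mapsto\bar x$ and $(\bar x,\bar y,w)\mapsto\bar y$ on $\mathfrak{B}(\mathcal{D},A,\delta)$, and the conchoid $\mathfrak{C}(\mathcal{D},A,\delta)$ is the Zariski closure of $\pi_1(\mathfrak{B}(\mathcal{D},A,\delta))$. $\mathcal{D}_0=\{(p_1,p_2)\in\mathcal{D}:(p_1-a)^2+(p_2-b)^2\neq0\}$. An irreducible component $\mathcal{M}$ of $\mathfrak{C}(\mathcal{C},A,d)$ is called simple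 if there is a non-empty Zariski dense subset $\Omega\subset\mathcal{M}$ such that $\mathrm{Card}(\pi_2(\pi_1^{-1}(Q)))=1$ for all $Q\in\Omega$ (projections associated with $\mathfrak{B}(\mathcal{C},A,d)$); otherwise it is called special. A circle centered at $A$ of radius $r$ is $(y_1-a)^2+(y_2-b)^2=r^2$. *)

theory Defs
  imports "HOL-Computational_Algebra.Polynomial"
begin

text \<open>Bivariate polynomials K[y1,y2] are represented as (K[y1])[y2], i.e. 'a poly poly.
  Evaluation at the point (y1,y2):\<close>
definition eval2 :: "'a::comm_ring_1 poly poly \<Rightarrow> 'a \<times> 'a \<Rightarrow> 'a" where
  "eval2 g p = poly (map_poly (\<lambda>c. poly c (fst p)) g) (snd p)"

definition zero_set2 :: "'a::comm_ring_1 poly poly set \<Rightarrow> ('a \<times> 'a) set" where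
  "zero_set2 S = {p. \<forall>g\<in>S. eval2 g p = 0}"

definition zariski_closed2 :: "('a::comm_ring_1 \<times> 'a) set \<Rightarrow> bool" where
  "zariski_closed2 X \<longleftrightarrow> (\<exists>S. X = zero_set2 S)"

definition zariski_closure2 :: "('a::comm_ring_1 \<times> 'a) set \<Rightarrow> ('a \<times> 'a) set" where
  "zariski_closure2 X = \<Inter>{Z. zariski_closed2 Z \<and> X \<subseteq> Z}"

definition zariski_irreducible2 :: "('a::comm_ring_1 \<times> 'a) set \<Rightarrow> bool" where
  "zariski_irreducible2 X \<longleftrightarrow> X \<noteq> {} \<and>
     (\<forall>Z1 Z2. zariski_closed2 Z1 \<longrightarrow> zariski_closed2 Z2 \<longrightarrow> X \<subseteq> Z1 \<union> Z2 \<longrightarrow>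
        X \<subseteq> Z1 \<or> X \<subseteq> Z2)"

definition irreducible_component2 :: "('a::comm_ring_1 \<times> 'a) set \<Rightarrow> ('a \<times> 'a) set \<Rightarrow> bool" where
  "irreducible_component2 M Y \<longleftrightarrow> zariski_closed2 M \<and> zariski_irreducible2 M \<and> M \<subseteq> Y \<and>
     (\<forall>N. zariski_closed2 N \<longrightarrow> zariski_irreducible2 N \<longrightarrow> M \<subseteq> N \<longrightarrow> N \<subseteq> Y \<longrightarrow> N = M)"

definition irreducible_plane_curve :: "('a::idom \<times> 'a) set \<Rightarrow> bool" where
  "irreducible_plane_curve C \<longleftrightarrow> (\<exists>g :: 'a poly poly. irreducible g \<and> C = zero_set2 {g})"

text \<open>The incidence set B(D,A,delta) \<subseteq> K^2 x K^2 x K (the condition g(y)=0 is y \<in> D)\<close>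
definition Bset :: "('a::field \<times> 'a) set \<Rightarrow> 'a \<times> 'a \<Rightarrow> 'a \<Rightarrow> (('a \<times> 'a) \<times> ('a \<times> 'a) \<times> 'a) set" where
  "Bset D A \<delta> = {(x, y, w). y \<in> D \<and>
      (fst x - fst y)^2 + (snd x - snd y)^2 = \<delta>^2 \<and>
      (snd y - snd A) * (fst x - fst y) - (fst y - fst A) * (snd x - snd y) = 0 \<and>
      w * ((fst y - fst A)^2 + (snd y - snd A)^2) = 1}"

definition conchoid :: "('a::field \<times> 'a) set \<Rightarrow> 'a \<times> 'a \<Rightarrow> 'a \<Rightarrow> ('a \<times> 'a) set" where
  "conchoid D A \<delta> = zariski_closure2 ((\<lambda>(x, y, w). x) ` Bset D A \<delta>)"

definition fibre_points :: "('a::field \<times> 'a) set \<Rightarrow> 'a \<times> 'a \<Rightarrow> 'a \<Rightarrow> 'a \<times> 'a \<Rightarrow> ('a \<times> 'a) set" where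
  "fibre_points C A d Q = (\<lambda>(x, y, w). y) ` {t \<in> Bset C A d. fst t = Q}"

definition simple_component :: "('a::field \<times> 'a) set \<Rightarrow> 'a \<times> 'a \<Rightarrow> 'a \<Rightarrow> ('a \<times> 'a) set \<Rightarrow> bool" where
  "simple_component C A d M \<longleftrightarrow> (\<exists>\<Omega>. \<Omega> \<subseteq> M \<and> \<Omega> \<noteq> {} \<and> M \<subseteq> zariski_closure2 \<Omega> \<and>
       (\<forall>Q\<in>\<Omega>. card (fibre_points C A d Q) = 1))"

definition special_component :: "('a::field \<times> 'a) set \<Rightarrow> 'a \<times> 'a \<Rightarrow> 'a \<Rightarrow> ('a \<times> 'a) set \<Rightarrow> bool" where
  "special_component C A d M \<longleftrightarrow> \<not> simple_component C A d M"

definition C0 :: "('a::field \<times> 'a) set \<Rightarrow> 'a \<times> 'a \<Rightarrow> ('a \<times> 'a) set" where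
  "C0 D A = {p \<in> D. (fst p - fst A)^2 + (snd p - snd A)^2 \<noteq> 0}"

definition is_circle_centered :: "('a::field \<times> 'a) set \<Rightarrow> 'a \<times> 'a \<Rightarrow> bool" where
  "is_circle_centered D A \<longleftrightarrow> (\<exists>r. D = {y. (fst y - fst A)^2 + (snd y - snd A)^2 = r^2})"

end

(* Write N(y) = |y - A|^2. A point of the conchoid over y in C is x = y + t (y - A) with
   t^2 N(y) = d^2; since N(x) = (1 + t)^2 N(y), the same relation with parameter -t / (1 + t)
   leads from x back to y. Thus for generic Q in a component M the candidates for points of C over
   Q are the two points Q + s (Q - A) and Q - s (Q - A) with s^2 N(Q) = d^2, and these are also the
   points that generate the conchoid of M. Each component M lies over a dense part of C, so C is
   always contained in the conchoid of M, and equality means that generically both candidates lie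
   on C, i.e. that the generic fibre does not have exactly one point.

   That each component dominates C is seen as follows. If the incidence set is reducible, the norm
   from K(C)(t) to K(C) yields polynomials E, F with N E^2 = d^2 F^2 on C, so that t = E/F or
   t = -E/F, and each of these two branches is the image of C under a rational map. *)

theory Submission
  imports Defs
begin

section \<open>Irreducible plane curves\<close>

lemma eval2_pCons [simp]: "eval2 (pCons c g) p = poly c (fst p) + snd p * eval2 g p"
  by (simp add: eval2_def map_poly_pCons)

lemma eval2_0 [simp]: "eval2 0 p = 0"
  by (simp add: eval2_def)

lemma eval2_eq_poly_poly: "eval2 g p = poly (poly g [:snd p:]) (fst p)"
  by (induction g) (simp_all add: algebra_simps)

lemma eval2_add: "eval2 (g + h) p = eval2 g p + eval2 h p"
  by (simp add: eval2_eq_poly_poly)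

lemma eval2_mult: "eval2 (g * h) p = eval2 g p * eval2 h p"
  by (simp add: eval2_eq_poly_poly)

lemma eval2_smult: "eval2 (smult c g) p = poly c (fst p) * eval2 g p"
  by (simp add: eval2_eq_poly_poly)

lemma zero_set2_single: "p \<in> zero_set2 {g} \<longleftrightarrow> eval2 g p = 0"
  by (simp add: zero_set2_def)

section \<open>Gauss's lemma and Bezout identities for polynomials in two variables\<close>

lemma smult_linear_if_vertical_line:
  fixes m :: "'a :: {idom, ring_char_0} poly poly"
  assumes "\<And>y. eval2 m (\<alpha>, y) = 0"
  obtains m' where "m = smult [:-\<alpha>, 1:] m'"
proof -
  \<comment> \<open>The restriction of \<open>m\<close> to the vertical line has infinitely many
    zeros, so it is the zero polynomial and every coefficient of \<open>m\<close> has the root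
    \<alpha>.\<close>
  have "map_poly (\<lambda>c. poly c \<alpha>) m = 0"
    using assms by (intro poly_eq_poly_eq_iff[THEN iffD1] ext) (simp add: eval2_def)
  then have "poly (coeff m n) \<alpha> = 0" for n
    by (metis coeff_0 coeff_map_poly poly_0)
  then have "[:[:-\<alpha>, 1:]:] dvd m"
    by (simp add: const_poly_dvd_iff poly_eq_0_iff_dvd)
  then show ?thesis
    using that by (auto elim!: dvdE)
qed

text \<open>Restriction to a vertical line is multiplicative with values in polynomials in one
  variable, which have no zero divisors.\<close>

lemma vertical_line_mult:
  fixes m q :: "'a :: {idom, ring_char_0} poly poly"
  assumes "\<And>y. eval2 (m * q) (\<alpha>, y) = 0"
  shows "(\<forall>y. eval2 m (\<alpha>, y) = 0) \<or> (\<forall>y. eval2 q (\<alpha>, y) = 0)"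
proof -
  let ?ev = "map_poly (\<lambda>c. poly c \<alpha>)"
  have "poly (?ev m * ?ev q) y = 0" for y
    using assms[of y] unfolding eval2_mult by (simp add: eval2_def)
  then have "?ev m * ?ev q = 0"
    by (metis poly_0 poly_eq_poly_eq_iff ext)
  then show ?thesis
    by (auto simp: eval2_def)
qed

text \<open>Gauss's lemma; as the base field is algebraically closed, it suffices to cancel linear
  factors of the constant one at a time.\<close>
lemma smult_factorization:
  fixes g m q :: "'a :: {alg_closed_field, field_char_0} poly poly"
  assumes "c \<noteq> 0" and "smult c g = m * q"
  shows "\<exists>m' q' c1. g = m' * q' \<and> c1 \<noteq> 0 \<and> m = smult c1 m'"
  using assms
proof (induction "degree c" arbitrary: c m q)
  case 0
  then obtain k where k: "c = [:k:]" "k \<noteq> 0"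
    by (metis degree_eq_zeroE pCons_0_0)
  have "g = smult [:1/k:] (smult c g)"
    using k by (simp flip: one_pCons)
  also have "\<dots> = m * smult [:1/k:] q"
    by (simp add: 0)
  finally show ?case
    by (metis one_neq_zero smult_1_left)
next
  case (Suc n)
  then obtain \<alpha> where "poly c \<alpha> = 0"
    using alg_closed_imp_poly_has_root[of c] by auto
  then obtain c' where c': "c = [:-\<alpha>, 1:] * c'"
    by (auto simp: poly_eq_0_iff_dvd elim!: dvdE)
  then have c'0: "c' \<noteq> 0" and deg: "n = degree c'"
    using Suc by (auto simp: degree_mult_eq simp del: mult_pCons_left)
  \<comment> \<open>A root of \<open>c\<close> makes the product vanish on a whole vertical line, so
    the linear factor divides \<open>m\<close> or \<open>q\<close>. In the first case it is
    collected in \<open>c1\<close>, in the second \<open>m\<close> stays unchanged.\<close>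
  have "eval2 (m * q) (\<alpha>, y) = 0" for y
    unfolding Suc.prems(2)[symmetric] by (simp add: eval2_smult \<open>poly c \<alpha> = 0\<close>)
  from vertical_line_mult[OF this] show ?case
  proof
    assume "\<forall>y. eval2 m (\<alpha>, y) = 0"
    then obtain m1 where m1: "m = smult [:-\<alpha>, 1:] m1"
      using smult_linear_if_vertical_line by blast
    have "smult [:-\<alpha>, 1:] (smult c' g) = smult [:-\<alpha>, 1:] (m1 * q)"
      using Suc.prems(2) unfolding c' m1 by (simp only: smult_smult mult_smult_left)
    then have "smult c' g = m1 * q"
      by (rule smult_cancel[rotated]) simp
    from Suc.hyps(1)[OF deg c'0 this] obtain m' q' c1
      where "g = m' * q'" "c1 \<noteq> 0" "m1 = smult c1 m'" by blast
    then show ?thesis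
      unfolding m1 by (metis mult_eq_0_iff pCons_eq_0_iff smult_smult zero_neq_one)
  next
    assume "\<forall>y. eval2 q (\<alpha>, y) = 0"
    then obtain q1 where q1: "q = smult [:-\<alpha>, 1:] q1"
      using smult_linear_if_vertical_line by blast
    have "smult [:-\<alpha>, 1:] (smult c' g) = smult [:-\<alpha>, 1:] (m * q1)"
      using Suc.prems(2) unfolding c' q1 by (simp only: smult_smult mult_smult_right)
    then have "smult c' g = m * q1"
      by (rule smult_cancel[rotated]) simp
    from Suc.hyps(1)[OF deg c'0 this] show ?thesis .
  qed
qed

text \<open>Gauss's lemma writes \<open>g\<close> as a constant times a divisor of \<open>h\<close>.
  Since \<open>g\<close> is irreducible of positive degree in the second variable, that constant is
  a unit.\<close>

lemma irreducible_dvd_if_dvd_smult: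
  fixes g h :: "'a :: {alg_closed_field, field_char_0} poly poly"
  assumes g: "irreducible g" "degree g > 0" and c: "c \<noteq> 0" "smult c h = g * q"
  shows "g dvd h"
proof -
  obtain g' q' c1 where *: "h = g' * q'" "c1 \<noteq> 0" "g = smult c1 g'"
    using smult_factorization[OF c] by blast
  have "g = [:c1:] * g'"
    using * by simp
  with g have "[:c1:] dvd 1 \<or> g' dvd 1"
    using irreducibleD by blast
  moreover have "\<not> g' dvd 1"
    using g * by (auto simp: is_unit_poly_iff)
  ultimately have "[:c1:] dvd 1"
    by blast
  then have "g dvd g'"
    using \<open>g = [:c1:] * g'\<close> by (metis dvd_refl mult_unit_dvd_iff')
  then show ?thesis
    using * by simp
qed

text \<open>This is the Euclidean algorithm over the field of rational functions in the first
  variable, with denominators cleared. A non-zero combination \<open>m\<close> of least degree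
  divides \<open>g\<close> and \<open>h\<close> up to non-zero constants; if its degree were
  positive, Gauss's lemma would give \<open>g dvd h\<close>.\<close>

lemma irreducible_bezout:
  fixes g h :: "'a :: {alg_closed_field, field_char_0} poly poly"
  assumes g: "irreducible g" "degree g > 0" and ndvd: "\<not> g dvd h"
  obtains u v r where "r \<noteq> 0" and "u * g + v * h = [:r:]"
proof -
  define I where "I = {m. m \<noteq> 0 \<and> (\<exists>u v. m = u * g + v * h)}"
  have "g \<noteq> 0"
    using g by auto
  have "g = 1 * g + 0 * h" "h = 0 * g + 1 * h"
    by simp_all
  then have "g \<in> I"
    using \<open>g \<noteq> 0\<close> unfolding I_def by blast
  define m where "m = arg_min degree (\<lambda>m. m \<in> I)"
  have "m \<in> I" and min: "\<And>k. k \<in> I \<Longrightarrow> degree m \<le> degree k"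
    using arg_min_nat_lemma[of "\<lambda>m. m \<in> I", OF \<open>g \<in> I\<close>, of degree] unfolding m_def by auto
  then obtain u v where m: "m \<noteq> 0" "m = u * g + v * h"
    unfolding I_def by auto
  have multiple: "\<exists>c q. c \<noteq> 0 \<and> smult c f = m * q" if f: "f = u' * g + v' * h" for f u' v'
  proof -
    \<comment> \<open>Pseudo-division keeps the coefficients polynomial. The remainder is again a
      combination of \<open>g\<close> and \<open>h\<close>, so minimality of \<open>m\<close> forces
      it to be zero.\<close>
    obtain q r where qr: "pseudo_divmod f m = (q, r)"
      by fastforce
    define c where "c = lead_coeff m ^ (Suc (degree f) - degree m)"
    have c: "smult c f = m * q + r" and r: "r = 0 \<or> degree r < degree m"
      using pseudo_divmod[OF m(1) qr] unfolding c_def by simp_all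
    have "c \<noteq> 0"
      using m(1) by (simp add: c_def)
    have "r = smult c f - m * q"
      using c by simp
    also have "\<dots> = ([:c:] * u' - q * u) * g + ([:c:] * v' - q * v) * h"
      unfolding f m(2) by (simp add: algebra_simps smult_add_right)
    finally have "r \<in> I" if "r \<noteq> 0"
      using that unfolding I_def by blast
    then have "r = 0"
      using r min by force
    then show ?thesis
      using c \<open>c \<noteq> 0\<close> by auto
  qed
  have "degree m = 0"
  proof (rule ccontr)
    assume "degree m \<noteq> 0"
    obtain c q where "c \<noteq> 0" "smult c g = m * q"
      using multiple[OF \<open>g = 1 * g + 0 * h\<close>] by blast
    then obtain m' q' c1 where *: "g = m' * q'" "c1 \<noteq> 0" "m = smult c1 m'"
      using smult_factorization by blast
    have "\<not> m' dvd 1"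
      using \<open>degree m \<noteq> 0\<close> * by (auto simp: is_unit_poly_iff)
    then have "q' dvd 1"
      using g(1) * irreducibleD by blast
    then have "g dvd m'"
      by (simp add: * mult_unit_dvd_iff)
    then obtain e where e: "m = g * e"
      using * by (metis dvdE dvd_smult)
    obtain c2 q2 where "c2 \<noteq> 0" "smult c2 h = m * q2"
      using multiple[OF \<open>h = 0 * g + 1 * h\<close>] by blast
    then have "smult c2 h = g * (e * q2)"
      by (simp add: e mult.assoc)
    then show False
      using irreducible_dvd_if_dvd_smult[OF g \<open>c2 \<noteq> 0\<close>] ndvd by blast
  qed
  then obtain r where "m = [:r:]"
    by (metis degree_eq_zeroE)
  then show ?thesis
    using that[of r u v] m by auto
qed

section \<open>Points of a plane curve and their abscissae\<close>

lemma finite_common_abscissae: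
  fixes g h :: "'a :: {alg_closed_field, field_char_0} poly poly"
  assumes "irreducible g" "degree g > 0" "\<not> g dvd h"
  shows "finite {x. \<exists>y. eval2 g (x, y) = 0 \<and> eval2 h (x, y) = 0}"
proof -
  obtain u v r where r: "r \<noteq> 0" "u * g + v * h = [:r:]"
    using irreducible_bezout[OF assms] .
  \<comment> \<open>At a common zero the Bezout identity leaves only \<open>r\<close>, a non-zero
    polynomial in the abscissa.\<close>
  have "poly r x = 0" if "eval2 g (x, y) = 0" "eval2 h (x, y) = 0" for x y
    using arg_cong[OF r(2), of "\<lambda>f. eval2 f (x, y)"] that by (simp add: eval2_add eval2_mult)
  then show ?thesis
    by (intro finite_subset[OF _ poly_roots_finite[OF r(1)]]) auto
qed

text \<open>Wherever the leading coefficient does not vanish, the specialised polynomial keeps its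
  positive degree and has a root. Only finitely many abscissae are excluded in this way.\<close>

lemma infinite_abscissae:
  fixes g :: "'a :: {alg_closed_field, field_char_0} poly poly"
  assumes "degree g > 0"
  shows "infinite {x. \<exists>y. eval2 g (x, y) = 0}"
proof
  let ?X = "{x. \<exists>y. eval2 g (x, y) = 0}"
  assume "finite ?X"
  have "lead_coeff g \<noteq> 0"
    using assms by auto
  then have "finite (?X \<union> {x. poly (lead_coeff g) x = 0})"
    using \<open>finite ?X\<close> poly_roots_finite by blast
  then obtain x where x: "x \<notin> ?X" "poly (lead_coeff g) x \<noteq> 0"
    using ex_new_if_finite[OF infinite_UNIV_char_0] by blast
  have "coeff (map_poly (\<lambda>c. poly c x) g) (degree g) \<noteq> 0"
    using x by (simp add: coeff_map_poly)
  then have "degree (map_poly (\<lambda>c. poly c x) g) > 0"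
    using assms le_degree by fastforce
  then obtain y where "poly (map_poly (\<lambda>c. poly c x) g) y = 0"
    using alg_closed_imp_poly_has_root by blast
  then show False
    using x by (auto simp: eval2_def)
qed

text \<open>Such a \<open>g\<close> is a polynomial in the first variable alone, and irreducibility
  over an algebraically closed field makes it linear.\<close>

lemma irreducible_degree_0_vertical_line:
  fixes g :: "'a :: {alg_closed_field, field_char_0} poly poly"
  assumes "irreducible g" "degree g = 0"
  obtains \<alpha> where "zero_set2 {g} = {p. fst p = \<alpha>}"
proof -
  obtain c where c: "g = [:c:]"
    using assms by (metis degree_eq_zeroE)
  have "c \<noteq> 0"
    using assms c by auto
  have "degree c > 0"
  proof (rule ccontr)
    assume "\<not> degree c > 0"
    then have "c dvd 1"
      using \<open>c \<noteq> 0\<close> by (simp add: is_unit_iff_degree)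
    then have "g dvd 1"
      using c by (simp add: is_unit_const_poly_iff)
    then show False
      using assms(1) irreducible_not_unit by blast
  qed
  then obtain \<alpha> where "poly c \<alpha> = 0"
    using alg_closed_imp_poly_has_root by blast
  then obtain c' where c': "c = [:-\<alpha>, 1:] * c'"
    by (auto simp: poly_eq_0_iff_dvd elim!: dvdE)
  have "g = [:[:-\<alpha>, 1:]:] * [:c':]"
    unfolding c c' by simp
  moreover have "\<not> [:[:-\<alpha>, 1:]:] dvd 1"
    by (simp add: is_unit_const_poly_iff is_unit_iff_degree)
  ultimately have "[:c':] dvd 1"
    using assms(1) irreducibleD by blast
  then have "c' dvd 1"
    by (simp add: is_unit_const_poly_iff)
  then obtain k where "c' = [:k:]" "k \<noteq> 0"
    by (metis is_unit_poly_iff dvd_0_left_iff one_neq_zero)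
  then have "zero_set2 {g} = {p. fst p = \<alpha>}"
    unfolding c c' by (auto simp: zero_set2_def)
  then show ?thesis
    using that by blast
qed

lemma infinite_irreducible_plane_curve:
  fixes C :: "('a :: {alg_closed_field, field_char_0} \<times> 'a) set"
  assumes "irreducible_plane_curve C"
  shows "infinite C"
proof -
  obtain g :: "'a poly poly" where g: "irreducible g" "C = zero_set2 {g}"
    using assms unfolding irreducible_plane_curve_def by blast
  show ?thesis
  proof (cases "degree g > 0")
    case True
    have "{x. \<exists>y. eval2 g (x, y) = 0} = fst ` C"
      by (force simp: g zero_set2_single)
    then show ?thesis
      using infinite_abscissae[OF True] by auto
  next
    case False
    then obtain \<alpha> where "C = {p. fst p = \<alpha>}"
      using irreducible_degree_0_vertical_line g by blast
    then have "snd ` C = UNIV"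
      by (auto intro: image_eqI[of _ snd "(\<alpha>, _)"])
    then show ?thesis
      using infinite_UNIV_char_0 by (metis finite_imageI)
  qed
qed

section \<open>Zariski closure in terms of polynomial functions\<close>

text \<open>Working with functions allows explicit polynomial expressions to be recognised by
  introduction rules instead of by writing down their coefficients.\<close>

definition polyfun2 :: "('a :: comm_ring_1 \<times> 'a \<Rightarrow> 'a) \<Rightarrow> bool" where
  "polyfun2 f \<longleftrightarrow> (\<exists>g. \<forall>p. f p = eval2 g p)"

lemma polyfun2_eval2 [intro]: "polyfun2 (eval2 g)"
  unfolding polyfun2_def by blast

lemma polyfun2_const [intro]: "polyfun2 (\<lambda>p. c)"
  unfolding polyfun2_def by (rule exI[of _ "[:[:c:]:]"]) simp

lemma polyfun2_fst [intro]: "polyfun2 (\<lambda>p. fst p)"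
  unfolding polyfun2_def by (rule exI[of _ "[:[:0, 1:]:]"]) simp

lemma polyfun2_snd [intro]: "polyfun2 (\<lambda>p. snd p)"
  unfolding polyfun2_def by (rule exI[of _ "[:0, 1:]"]) (simp add: eval2_eq_poly_poly)

lemma polyfun2_add [intro]: "polyfun2 f \<Longrightarrow> polyfun2 h \<Longrightarrow> polyfun2 (\<lambda>p. f p + h p)"
  unfolding polyfun2_def by (metis eval2_add)

lemma polyfun2_mult [intro]: "polyfun2 f \<Longrightarrow> polyfun2 h \<Longrightarrow> polyfun2 (\<lambda>p. f p * h p)"
  unfolding polyfun2_def by (metis eval2_mult)

lemma polyfun2_diff [intro]: "polyfun2 f \<Longrightarrow> polyfun2 h \<Longrightarrow> polyfun2 (\<lambda>p. f p - h p)"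
  using polyfun2_add[of f "\<lambda>p. (-1) * h p"] by (simp add: polyfun2_mult[OF polyfun2_const, of h "-1", simplified])

lemma polyfun2_power [intro]: "polyfun2 f \<Longrightarrow> polyfun2 (\<lambda>p. f p ^ n)"
  by (induction n) auto

section \<open>Closed sets, closures and irreducibility\<close>

lemma zariski_closed2_zero_set2 [intro]: "zariski_closed2 (zero_set2 S)"
  unfolding zariski_closed2_def by blast

lemma zariski_closed2_zeros:
  assumes "polyfun2 f"
  shows "zariski_closed2 {p. f p = 0}"
proof -
  obtain g where "\<forall>p. f p = eval2 g p"
    using assms unfolding polyfun2_def by blast
  then have "{p. f p = 0} = zero_set2 {g}"
    by (auto simp: zero_set2_def)
  then show ?thesis
    by auto
qed

lemma zariski_closure2_iff:
  "p \<in> zariski_closure2 X \<longleftrightarrow> (\<forall>f. polyfun2 f \<longrightarrow> (\<forall>x\<in>X. f x = 0) \<longrightarrow> f p = 0)"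
proof
  assume p: "p \<in> zariski_closure2 X"
  show "\<forall>f. polyfun2 f \<longrightarrow> (\<forall>x\<in>X. f x = 0) \<longrightarrow> f p = 0"
  proof (intro allI impI)
    fix f :: "'a \<times> 'a \<Rightarrow> 'a"
    assume "polyfun2 f" "\<forall>x\<in>X. f x = 0"
    then show "f p = 0"
      using p zariski_closed2_zeros[of f] unfolding zariski_closure2_def by blast
  qed
next
  assume p: "\<forall>f. polyfun2 f \<longrightarrow> (\<forall>x\<in>X. f x = 0) \<longrightarrow> f p = 0"
  have "p \<in> Z" if Z: "zariski_closed2 Z" "X \<subseteq> Z" for Z
  proof -
    obtain S where S: "Z = zero_set2 S"
      using Z(1) unfolding zariski_closed2_def by blast
    have "eval2 g p = 0" if "g \<in> S" for g
      using Z(2) p[rule_format, OF polyfun2_eval2, of g] that unfolding S zero_set2_def by blast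
    then show ?thesis
      unfolding S zero_set2_def by blast
  qed
  then show "p \<in> zariski_closure2 X"
    unfolding zariski_closure2_def by blast
qed

lemma zariski_closure2_superset: "X \<subseteq> zariski_closure2 X"
  unfolding zariski_closure2_def by blast

lemma zariski_closure2_minimal: "zariski_closed2 Z \<Longrightarrow> X \<subseteq> Z \<Longrightarrow> zariski_closure2 X \<subseteq> Z"
  unfolding zariski_closure2_def by blast

lemma zariski_closure2_mono: "X \<subseteq> Y \<Longrightarrow> zariski_closure2 X \<subseteq> zariski_closure2 Y"
  unfolding zariski_closure2_def by blast

lemma zariski_closed2_closure: "zariski_closed2 (zariski_closure2 X)"
proof -
  have "zariski_closure2 X = zero_set2 {g. \<forall>x\<in>X. eval2 g x = 0}"
  proof (intro set_eqI iffI)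
    fix p
    assume "p \<in> zariski_closure2 X"
    then show "p \<in> zero_set2 {g. \<forall>x\<in>X. eval2 g x = 0}"
      using polyfun2_eval2 unfolding zariski_closure2_iff zero_set2_def by blast
  next
    fix p
    assume p: "p \<in> zero_set2 {g. \<forall>x\<in>X. eval2 g x = 0}"
    have "f p = 0" if f: "polyfun2 f" "\<forall>x\<in>X. f x = 0" for f
    proof -
      obtain g where g: "f = eval2 g"
        using f(1) unfolding polyfun2_def by blast
      show ?thesis
        using f(2) p unfolding zero_set2_def g by blast
    qed
    then show "p \<in> zariski_closure2 X"
      unfolding zariski_closure2_iff by blast
  qed
  then show ?thesis
    by auto
qed

lemma zariski_closed2_separate:
  assumes "zariski_closed2 Z" "p \<notin> Z"
  obtains f where "polyfun2 f" "\<forall>x\<in>Z. f x = 0" "f p \<noteq> 0"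
proof -
  obtain S where "Z = zero_set2 S"
    using assms(1) unfolding zariski_closed2_def by blast
  then obtain g where "g \<in> S" "eval2 g p \<noteq> 0"
    using assms(2) unfolding zero_set2_def by blast
  then show ?thesis
    using that[of "eval2 g"] \<open>Z = zero_set2 S\<close> by (auto simp: zero_set2_def)
qed

lemma zariski_irreducible2D:
  "zariski_irreducible2 X \<Longrightarrow> zariski_closed2 Z1 \<Longrightarrow> zariski_closed2 Z2 \<Longrightarrow> X \<subseteq> Z1 \<union> Z2 \<Longrightarrow>
    X \<subseteq> Z1 \<or> X \<subseteq> Z2"
  unfolding zariski_irreducible2_def by blast

lemma zariski_closure2D:
  "p \<in> zariski_closure2 X \<Longrightarrow> polyfun2 f \<Longrightarrow> (\<And>x. x \<in> X \<Longrightarrow> f x = 0) \<Longrightarrow> f p = 0"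
  unfolding zariski_closure2_iff by blast

text \<open>Irreducibility means that the ring of polynomial functions on \<open>X\<close> has no
  zero divisors. Conversely, two points of \<open>X\<close> missing \<open>Z1\<close> and
  \<open>Z2\<close> respectively are detected by functions whose product vanishes on
  \<open>X\<close>.\<close>

lemma zariski_irreducible2_iff:
  fixes X :: "('a :: idom \<times> 'a) set"
  shows "zariski_irreducible2 X \<longleftrightarrow> X \<noteq> {} \<and>
    (\<forall>f h. polyfun2 f \<longrightarrow> polyfun2 h \<longrightarrow> (\<forall>x\<in>X. f x * h x = 0) \<longrightarrow>
       (\<forall>x\<in>X. f x = 0) \<or> (\<forall>x\<in>X. h x = 0))"
    (is "_ \<longleftrightarrow> _ \<and> ?R")
proof (intro iffI conjI)
  assume irr: "zariski_irreducible2 X"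
  then show "X \<noteq> {}"
    unfolding zariski_irreducible2_def by blast
  show ?R
  proof (intro allI impI)
    fix f h :: "'a \<times> 'a \<Rightarrow> 'a"
    assume fh: "polyfun2 f" "polyfun2 h" "\<forall>x\<in>X. f x * h x = 0"
    then have "X \<subseteq> {p. f p = 0} \<union> {p. h p = 0}"
      by auto
    then have "X \<subseteq> {p. f p = 0} \<or> X \<subseteq> {p. h p = 0}"
      using irr fh(1,2) zariski_closed2_zeros unfolding zariski_irreducible2_def by blast
    then show "(\<forall>x\<in>X. f x = 0) \<or> (\<forall>x\<in>X. h x = 0)"
      by blast
  qed
next
  assume R: "X \<noteq> {} \<and> ?R"
  have "X \<subseteq> Z1 \<or> X \<subseteq> Z2"
    if Z: "zariski_closed2 Z1" "zariski_closed2 Z2" "X \<subseteq> Z1 \<union> Z2" for Z1 Z2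
  proof (rule ccontr)
    assume "\<not> (X \<subseteq> Z1 \<or> X \<subseteq> Z2)"
    then obtain x y where xy: "x \<in> X" "x \<notin> Z1" "y \<in> X" "y \<notin> Z2"
      by blast
    obtain f where f: "polyfun2 f" "\<forall>x\<in>Z1. f x = 0" "f x \<noteq> 0"
      using zariski_closed2_separate[OF Z(1) xy(2)] .
    obtain h where h: "polyfun2 h" "\<forall>x\<in>Z2. h x = 0" "h y \<noteq> 0"
      using zariski_closed2_separate[OF Z(2) xy(4)] .
    have "\<forall>x\<in>X. f x * h x = 0"
      using f(2) h(2) Z(3) by fastforce
    then show False
      using R f h xy by blast
  qed
  then show "zariski_irreducible2 X"
    using R unfolding zariski_irreducible2_def by blast
qed

lemma zariski_irreducible2_closure:
  fixes X :: "('a :: idom \<times> 'a) set"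
  assumes "zariski_irreducible2 X"
  shows "zariski_irreducible2 (zariski_closure2 X)"
  using assms zariski_closure2_superset[of X] zariski_closure2_minimal[of _ X]
  unfolding zariski_irreducible2_def by (metis order_trans subset_empty)

lemma irreducible_component2_eq:
  assumes "irreducible_component2 M Y" "zariski_irreducible2 N" "zariski_closed2 N" "N \<subseteq> Y" "M \<subseteq> N"
  shows "M = N"
  using assms unfolding irreducible_component2_def by blast

lemma irreducible_plane_curve_closed: "irreducible_plane_curve C \<Longrightarrow> zariski_closed2 C"
  unfolding irreducible_plane_curve_def by auto

text \<open>If \<open>g\<close> divided neither factor, all points of the curve would lie over the
  finitely many abscissae where \<open>g\<close> has a common zero with \<open>k\<close> or with
  \<open>l\<close>. A vertical line is treated separately, because it has only one abscissa.\<close>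

lemma irreducible_plane_curve_irreducible:
  fixes C :: "('a :: {alg_closed_field, field_char_0} \<times> 'a) set"
  assumes "irreducible_plane_curve C"
  shows "zariski_irreducible2 C"
proof -
  obtain g :: "'a poly poly" where g: "irreducible g" "C = zero_set2 {g}"
    using assms unfolding irreducible_plane_curve_def by blast
  have "(\<forall>p\<in>C. eval2 k p = 0) \<or> (\<forall>p\<in>C. eval2 l p = 0)"
    if kl: "\<forall>p\<in>C. eval2 k p * eval2 l p = 0" for k l
  proof (cases "degree g > 0")
    case True
    have "g dvd k \<or> g dvd l"
    proof (rule ccontr)
      assume "\<not> (g dvd k \<or> g dvd l)"
      then have "finite ({x. \<exists>y. eval2 g (x, y) = 0 \<and> eval2 k (x, y) = 0}
          \<union> {x. \<exists>y. eval2 g (x, y) = 0 \<and> eval2 l (x, y) = 0})"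
        using finite_common_abscissae[OF g(1) True] by blast
      moreover have "{x. \<exists>y. eval2 g (x, y) = 0} \<subseteq>
          {x. \<exists>y. eval2 g (x, y) = 0 \<and> eval2 k (x, y) = 0}
          \<union> {x. \<exists>y. eval2 g (x, y) = 0 \<and> eval2 l (x, y) = 0}"
        using kl by (auto simp: g zero_set2_single)
      ultimately show False
        using infinite_abscissae[OF True] finite_subset by blast
    qed
    then show ?thesis
      by (auto simp: g zero_set2_single eval2_mult elim!: dvdE)
  next
    case False
    then obtain \<alpha> where "C = {p. fst p = \<alpha>}"
      using irreducible_degree_0_vertical_line g by blast
    then show ?thesis
      using kl vertical_line_mult[of k l \<alpha>] by (force simp: eval2_mult)
  qed
  then have "(\<forall>p\<in>C. f p = 0) \<or> (\<forall>p\<in>C. h p = 0)"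
    if "polyfun2 f" "polyfun2 h" "\<forall>p\<in>C. f p * h p = 0" for f h
    using that unfolding polyfun2_def by metis
  moreover have "C \<noteq> {}"
    using infinite_irreducible_plane_curve[OF assms] by auto
  ultimately show ?thesis
    unfolding zariski_irreducible2_iff by blast
qed

section \<open>Conchoids\<close>

text \<open>Used to pull polynomial functions back along rational parametrisations, for which only
  constants, coordinates, sums and products have to be checked.\<close>

lemma polyfun2_induct [consumes 1, case_names const fst snd add mult]:
  assumes "polyfun2 f"
    and const: "\<And>c. P (\<lambda>p. c)"
    and fst: "P (\<lambda>p. fst p)"
    and snd: "P (\<lambda>p. snd p)"
    and add: "\<And>f h. P f \<Longrightarrow> P h \<Longrightarrow> P (\<lambda>p. f p + h p)"
    and mult: "\<And>f h. P f \<Longrightarrow> P h \<Longrightarrow> P (\<lambda>p. f p * h p)"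
  shows "P f"
proof -
  obtain g where "f = eval2 g"
    using assms(1) unfolding polyfun2_def by blast
  have inner: "P (\<lambda>p. poly c (fst p))" for c
  proof (induction c)
    case 0
    show ?case
      using const[of 0] by simp
  next
    case (pCons c q)
    show ?case
      using add[OF const[of c] mult[OF fst pCons(2)]] by simp
  qed
  have "P (\<lambda>p. eval2 g p)"
  proof (induction g)
    case 0
    show ?case
      using const[of 0] by simp
  next
    case (pCons c q)
    show ?case
      using add[OF inner[of c] mult[OF snd pCons(2)]] by simp
  qed
  then show ?thesis
    by (simp add: \<open>f = eval2 g\<close>)
qed

section \<open>Parametrisation of the incidence set by homotheties\<close>

definition sq_dist :: "'a::comm_ring_1 \<times> 'a \<Rightarrow> 'a \<times> 'a \<Rightarrow> 'a" where
  "sq_dist A y = (fst y - fst A)^2 + (snd y - snd A)^2"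

text \<open>The homothety with centre \<open>A\<close> and ratio \<open>1 + t\<close>.\<close>

definition shift :: "'a::comm_ring_1 \<times> 'a \<Rightarrow> 'a \<Rightarrow> 'a \<times> 'a \<Rightarrow> 'a \<times> 'a" where
  "shift A t y = (fst y + t * (fst y - fst A), snd y + t * (snd y - snd A))"

text \<open>The projection of the incidence set before taking the closure. The parameter
  \<open>t\<close> encodes collinearity with \<open>A\<close>, and the condition
  \<open>sq_dist A y \<noteq> 0\<close> encodes the existence of \<open>w\<close>.\<close>

definition conchoid_points :: "('a::field \<times> 'a) set \<Rightarrow> 'a \<times> 'a \<Rightarrow> 'a \<Rightarrow> ('a \<times> 'a) set" where
  "conchoid_points D A \<delta> = {shift A t y | y t. y \<in> D \<and> sq_dist A y \<noteq> 0 \<and> t^2 * sq_dist A y = \<delta>^2}"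

lemma polyfun2_sq_dist [intro]: "polyfun2 (\<lambda>y. sq_dist A y)"
  unfolding sq_dist_def by (intro polyfun2_add polyfun2_power polyfun2_diff) auto

lemma sq_dist_shift: "sq_dist A (shift A t y) = (1 + t)^2 * sq_dist A y"
  by (simp add: sq_dist_def shift_def algebra_simps power2_eq_square)

text \<open>Ratios of homotheties with a common centre multiply, and \<open>-t / (1 + t)\<close> is
  the parameter of ratio \<open>1 / (1 + t)\<close>.\<close>

lemma shift_inverse:
  fixes A :: "'a::field \<times> 'a"
  assumes "1 + t \<noteq> 0"
  shows "shift A (- t / (1 + t)) (shift A t y) = y"
proof -
  have "shift A s (shift A t y) = y" if "(1 + s) * (1 + t) = 1" for s
    using that unfolding shift_def prod_eq_iff fst_conv snd_conv by (intro conjI; algebra)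
  then show ?thesis
    using assms by (simp add: field_simps)
qed

lemma shift_inj:
  fixes A :: "'a::field \<times> 'a"
  assumes "shift A s y = shift A t y" "sq_dist A y \<noteq> 0"
  shows "s = t"
  using assms by (auto simp: shift_def sq_dist_def)

lemma Bset_iff:
  fixes A :: "'a::field \<times> 'a"
  shows "(\<exists>w. (x, y, w) \<in> Bset D A \<delta>) \<longleftrightarrow>
    y \<in> D \<and> sq_dist A y \<noteq> 0 \<and> (\<exists>t. t^2 * sq_dist A y = \<delta>^2 \<and> x = shift A t y)"
proof -
  obtain x1 x2 y1 y2 a b where [simp]: "x = (x1, x2)" "y = (y1, y2)" "A = (a, b)"
    by (cases x, cases y, cases A)
  have "\<exists>t. x1 = y1 + t * (y1 - a) \<and> x2 = y2 + t * (y2 - b)"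
    if N: "(y1 - a)^2 + (y2 - b)^2 \<noteq> 0" and col: "(y2 - b) * (x1 - y1) - (y1 - a) * (x2 - y2) = 0"
  proof -
    \<comment> \<open>The coefficient of the orthogonal projection of \<open>x - y\<close> onto
      \<open>y - A\<close>; collinearity makes this projection equal to
      \<open>x - y\<close>.\<close>
    define t where "t = ((x1 - y1) * (y1 - a) + (x2 - y2) * (y2 - b)) / ((y1 - a)^2 + (y2 - b)^2)"
    have t: "t * ((y1 - a)^2 + (y2 - b)^2) = (x1 - y1) * (y1 - a) + (x2 - y2) * (y2 - b)"
      using N by (simp add: t_def)
    have "((y1 - a)^2 + (y2 - b)^2) * (x1 - (y1 + t * (y1 - a))) = 0"
      using t col by algebra
    moreover have "((y1 - a)^2 + (y2 - b)^2) * (x2 - (y2 + t * (y2 - b))) = 0"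
      using t col by algebra
    ultimately show ?thesis
      using N by auto
  qed
  note slope = this
  show ?thesis
  proof
    assume "\<exists>w. (x, y, w) \<in> Bset D A \<delta>"
    then obtain w where w: "y \<in> D" "(x1 - y1)^2 + (x2 - y2)^2 = \<delta>^2"
        "(y2 - b) * (x1 - y1) - (y1 - a) * (x2 - y2) = 0" "w * ((y1 - a)^2 + (y2 - b)^2) = 1"
      by (auto simp: Bset_def)
    then have N: "(y1 - a)^2 + (y2 - b)^2 \<noteq> 0"
      by auto
    obtain t where t: "x1 = y1 + t * (y1 - a)" "x2 = y2 + t * (y2 - b)"
      using slope[OF N w(3)] by blast
    have "t^2 * ((y1 - a)^2 + (y2 - b)^2) = \<delta>^2"
      unfolding w(2)[symmetric] t by (simp add: power_mult_distrib distrib_left)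
    then have "t^2 * sq_dist A y = \<delta>^2 \<and> x = shift A t y"
      by (simp add: sq_dist_def shift_def t)
    then show "y \<in> D \<and> sq_dist A y \<noteq> 0 \<and> (\<exists>t. t^2 * sq_dist A y = \<delta>^2 \<and> x = shift A t y)"
      using w(1) N by (auto simp: sq_dist_def)
  next
    assume "y \<in> D \<and> sq_dist A y \<noteq> 0 \<and> (\<exists>t. t^2 * sq_dist A y = \<delta>^2 \<and> x = shift A t y)"
    then obtain t where "y \<in> D" and N: "sq_dist A y \<noteq> 0"
      and t: "t^2 * sq_dist A y = \<delta>^2" "x = shift A t y"
      by blast
    have "(t * (y1 - a))^2 + (t * (y2 - b))^2 = \<delta>^2"
      using t(1) by (simp add: sq_dist_def power_mult_distrib distrib_left)
    then have "(x, y, inverse (sq_dist A y)) \<in> Bset D A \<delta>"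
      using \<open>y \<in> D\<close> N t(2) by (simp add: Bset_def shift_def sq_dist_def)
    then show "\<exists>w. (x, y, w) \<in> Bset D A \<delta>"
      by blast
  qed
qed

lemma conchoid_eq: "conchoid D A \<delta> = zariski_closure2 (conchoid_points D A \<delta>)"
proof -
  have "(\<lambda>(x, y, w). x) ` Bset D A \<delta> = {x. \<exists>y w. (x, y, w) \<in> Bset D A \<delta>}"
    by force
  also have "\<dots> = conchoid_points D A \<delta>"
    unfolding Bset_iff conchoid_points_def by blast
  finally show ?thesis
    by (simp add: conchoid_def)
qed

lemma fibre_points_eq:
  "fibre_points C A d Q = {y \<in> C. sq_dist A y \<noteq> 0 \<and> (\<exists>t. t^2 * sq_dist A y = d^2 \<and> Q = shift A t y)}"
proof -
  have "fibre_points C A d Q = {y. \<exists>w. (Q, y, w) \<in> Bset C A d}"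
    unfolding fibre_points_def by force
  then show ?thesis
    unfolding Bset_iff by auto
qed

text \<open>The parameter \<open>t\<close> is a square root of \<open>\<delta>\<^sup>2 / sq_dist A y\<close>, so polynomial expressions
  in \<open>shift A t y\<close> reduce to the form \<open>E y + t * F y\<close> up to denominators.\<close>
lemma polyfun2_shift:
  fixes A :: "'a::field \<times> 'a"
  assumes "polyfun2 f"
  shows "\<exists>k E F. polyfun2 E \<and> polyfun2 F \<and>
    (\<forall>y t. t^2 * sq_dist A y = \<delta>^2 \<longrightarrow> sq_dist A y ^ k * f (shift A t y) = E y + t * F y)"
  using assms
proof (induction rule: polyfun2_induct)
  case (const c)
  show ?case
    by (rule exI[of _ 0], rule exI[of _ "\<lambda>y. c"], rule exI[of _ "\<lambda>y. 0"]) auto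
next
  case fst
  show ?case
    by (rule exI[of _ 0], rule exI[of _ "\<lambda>y. fst y"], rule exI[of _ "\<lambda>y. fst y - fst A"])
      (auto simp: shift_def)
next
  case snd
  show ?case
    by (rule exI[of _ 0], rule exI[of _ "\<lambda>y. snd y"], rule exI[of _ "\<lambda>y. snd y - snd A"])
      (auto simp: shift_def)
next
  case (add f h)
  then obtain k E F l G H where *: "polyfun2 E" "polyfun2 F" "polyfun2 G" "polyfun2 H"
    and f: "\<And>y t. t^2 * sq_dist A y = \<delta>^2 \<Longrightarrow> sq_dist A y ^ k * f (shift A t y) = E y + t * F y"
    and h: "\<And>y t. t^2 * sq_dist A y = \<delta>^2 \<Longrightarrow> sq_dist A y ^ l * h (shift A t y) = G y + t * H y"
    by blast
  \<comment> \<open>Cross-multiplication brings both summands to the exponent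
    \<open>k + l\<close>.\<close>
  define E' where "E' y = sq_dist A y ^ l * E y + sq_dist A y ^ k * G y" for y
  define F' where "F' y = sq_dist A y ^ l * F y + sq_dist A y ^ k * H y" for y
  have "sq_dist A y ^ (k + l) * (f (shift A t y) + h (shift A t y)) = E' y + t * F' y"
    if "t^2 * sq_dist A y = \<delta>^2" for y t
  proof -
    have "sq_dist A y ^ (k + l) * (f (shift A t y) + h (shift A t y)) =
        sq_dist A y ^ l * (sq_dist A y ^ k * f (shift A t y)) + sq_dist A y ^ k * (sq_dist A y ^ l * h (shift A t y))"
      by (simp add: power_add algebra_simps)
    then show ?thesis
      unfolding f[OF that] h[OF that] E'_def F'_def by (simp add: algebra_simps)
  qed
  moreover have "polyfun2 E'" "polyfun2 F'"
    unfolding E'_def[abs_def] F'_def[abs_def] using *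
    by - (intro polyfun2_add polyfun2_mult polyfun2_power polyfun2_sq_dist; assumption)+
  ultimately show ?case
    by blast
next
  case (mult f h)
  then obtain k E F l G H where *: "polyfun2 E" "polyfun2 F" "polyfun2 G" "polyfun2 H"
    and f: "\<And>y t. t^2 * sq_dist A y = \<delta>^2 \<Longrightarrow> sq_dist A y ^ k * f (shift A t y) = E y + t * F y"
    and h: "\<And>y t. t^2 * sq_dist A y = \<delta>^2 \<Longrightarrow> sq_dist A y ^ l * h (shift A t y) = G y + t * H y"
    by blast
  \<comment> \<open>One more factor \<open>sq_dist A y\<close>, hence the exponent
    \<open>k + l + 1\<close>, turns the term with \<open>t^2\<close> into
    \<open>\<delta>^2 * (F y * H y)\<close>.\<close>
  define E' where "E' y = sq_dist A y * (E y * G y) + \<delta>^2 * (F y * H y)" for y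
  define F' where "F' y = sq_dist A y * (E y * H y + F y * G y)" for y
  have "sq_dist A y ^ (k + l + 1) * (f (shift A t y) * h (shift A t y)) = E' y + t * F' y"
    if t: "t^2 * sq_dist A y = \<delta>^2" for y t
  proof -
    have "sq_dist A y ^ (k + l + 1) * (f (shift A t y) * h (shift A t y)) =
        sq_dist A y * ((sq_dist A y ^ k * f (shift A t y)) * (sq_dist A y ^ l * h (shift A t y)))"
      by (simp add: power_add algebra_simps)
    also have "\<dots> = sq_dist A y * ((E y + t * F y) * (G y + t * H y))"
      by (simp add: f[OF t] h[OF t])
    also have "\<dots> = E' y + t * F' y"
      unfolding E'_def F'_def t[symmetric] by (simp add: algebra_simps power2_eq_square)
    finally show ?thesis .
  qed
  moreover have "polyfun2 E'" "polyfun2 F'"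
    unfolding E'_def[abs_def] F'_def[abs_def] using *
    by - (intro polyfun2_add polyfun2_mult polyfun2_const polyfun2_sq_dist; assumption)+
  ultimately show ?case
    by blast
qed

text \<open>The circle is parametrised rationally by non-zero \<open>u\<close>. The equation of
  \<open>C\<close> becomes a Laurent polynomial in \<open>u\<close> with infinitely many zeros,
  hence zero, so the whole circle lies in \<open>C\<close>.\<close>

lemma irreducible_plane_curve_eq_circle:
  fixes C :: "('a :: {alg_closed_field, field_char_0} \<times> 'a) set"
  assumes C: "irreducible_plane_curve C" and sub: "\<And>y. y \<in> C \<Longrightarrow> sq_dist A y = r^2" and "r \<noteq> 0"
  shows "C = {y. sq_dist A y = r^2}"
proof -
  obtain i :: 'a where i: "i^2 = -1"
    using nth_root_exists[of 2 "-1 :: 'a"] by auto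
  then have i_nz: "i \<noteq> 0"
    by auto
  \<comment> \<open>With \<open>i^2 = -1\<close> the squared distance factors as
    \<open>u * v\<close> in isotropic coordinates. On the circle \<open>v = r^2 / u\<close>, and
    \<open>pt\<close> recovers the point from \<open>u\<close>.\<close>
  define u where "u y = (fst y - fst A) + i * (snd y - snd A)" for y
  define pt where "pt u = (fst A + (u + r^2 / u) / 2, snd A + (u - r^2 / u) / (2 * i))" for u
  have circle: "u y \<noteq> 0 \<and> pt (u y) = y" if "sq_dist A y = r^2" for y
  proof -
    define v where "v = (fst y - fst A) - i * (snd y - snd A)"
    have "u y * v = sq_dist A y"
      using i unfolding u_def v_def sq_dist_def by algebra
    then have uv: "u y * v = r^2"
      using that by simp
    then have "u y \<noteq> 0"
      using \<open>r \<noteq> 0\<close> by auto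
    then have v: "r^2 / u y = v"
      using uv by (simp add: field_simps)
    have "fst A + (u y + v) / 2 = fst y"
      by (simp add: u_def v_def field_simps)
    moreover have "snd A + (u y - v) / (2 * i) = snd y"
      using i_nz by (simp add: u_def v_def field_simps)
    ultimately have "pt (u y) = y"
      unfolding pt_def v by (simp only: prod_eq_iff fst_conv snd_conv)
    then show ?thesis
      using \<open>u y \<noteq> 0\<close> by blast
  qed
  have laurent: "\<exists>k p. \<forall>u. u \<noteq> 0 \<longrightarrow> u ^ k * f (pt u) = poly p u" if "polyfun2 f" for f
    using that
  proof (induction rule: polyfun2_induct)
    case (const c)
    show ?case
      by (rule exI[of _ 0], rule exI[of _ "[:c:]"]) simp
  next
    case fst
    show ?case
      by (rule exI[of _ 1], rule exI[of _ "[:r^2 / 2, fst A, 1 / 2:]"])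
        (simp add: pt_def field_simps power2_eq_square)
  next
    case snd
    show ?case
      by (rule exI[of _ 1], rule exI[of _ "[:- (r^2 / (2 * i)), snd A, inverse (2 * i) :]"])
        (simp add: pt_def i_nz field_simps power2_eq_square)
  next
    case (add f h)
    then obtain k p l q where
      f: "\<And>u. u \<noteq> 0 \<Longrightarrow> u ^ k * f (pt u) = poly p u" and h: "\<And>u. u \<noteq> 0 \<Longrightarrow> u ^ l * h (pt u) = poly q u"
      by blast
    have "u ^ (k + l) * (f (pt u) + h (pt u)) = poly (monom 1 l * p + monom 1 k * q) u"
      if "u \<noteq> 0" for u
      by (simp add: f[OF that, symmetric] h[OF that, symmetric] poly_monom power_add algebra_simps)
    then show ?case
      by blast
  next
    case (mult f h)
    then obtain k p l q where
      f: "\<And>u. u \<noteq> 0 \<Longrightarrow> u ^ k * f (pt u) = poly p u" and h: "\<And>u. u \<noteq> 0 \<Longrightarrow> u ^ l * h (pt u) = poly q u"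
      by blast
    have "u ^ (k + l) * (f (pt u) * h (pt u)) = poly (p * q) u" if "u \<noteq> 0" for u
      by (simp add: f[OF that, symmetric] h[OF that, symmetric] power_add algebra_simps)
    then show ?case
      by blast
  qed
  obtain g :: "'a poly poly" where g: "C = zero_set2 {g}"
    using C unfolding irreducible_plane_curve_def by blast
  obtain k p where p: "\<And>u. u \<noteq> 0 \<Longrightarrow> u ^ k * eval2 g (pt u) = poly p u"
    using laurent[OF polyfun2_eval2[of g]] by blast
  have roots: "poly p (u y) = 0" if "y \<in> C" for y
  proof -
    have "eval2 g (pt (u y)) = 0"
      using circle[OF sub[OF that]] that by (simp add: g zero_set2_single)
    then show ?thesis
      using p[of "u y"] circle[OF sub[OF that]] by simp
  qed
  have "inj_on u C"
    using circle sub by (metis inj_onI)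
  then have "infinite (u ` C)"
    using infinite_irreducible_plane_curve[OF C] by (simp add: finite_image_iff)
  moreover have "u ` C \<subseteq> {x. poly p x = 0}"
    using roots by auto
  ultimately have "p = 0"
    using poly_roots_finite finite_subset by blast
  then have "y \<in> C" if "sq_dist A y = r^2" for y
    using p[of "u y"] circle[OF that] by (simp add: g zero_set2_single)
  then show ?thesis
    using sub by blast
qed

section \<open>Generic points of irreducible sets, and fibres over a point of the conchoid\<close>

lemma zariski_irreducible2_zeroD:
  fixes X :: "('a :: idom \<times> 'a) set"
  assumes "zariski_irreducible2 X" "polyfun2 q" "polyfun2 f" "\<exists>y\<in>X. q y \<noteq> 0"
    and "\<And>y. y \<in> X \<Longrightarrow> q y \<noteq> 0 \<Longrightarrow> f y = 0" and "y \<in> X"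
  shows "f y = 0"
proof -
  have "\<forall>y\<in>X. q y * f y = 0"
    using assms(5) by auto
  then show ?thesis
    using assms(1-4,6) unfolding zariski_irreducible2_iff by blast
qed

lemma zariski_irreducible2_ex_nonzero:
  fixes X :: "('a :: idom \<times> 'a) set"
  assumes "zariski_irreducible2 X" "polyfun2 f" "polyfun2 h" "\<exists>y\<in>X. f y \<noteq> 0" "\<exists>y\<in>X. h y \<noteq> 0"
  shows "\<exists>y\<in>X. f y * h y \<noteq> 0"
  using assms unfolding zariski_irreducible2_iff by blast

lemma ex_shift_parameter:
  fixes A :: "'a::alg_closed_field \<times> 'a"
  assumes "sq_dist A y \<noteq> 0"
  obtains t where "t^2 * sq_dist A y = \<delta>^2"
proof -
  obtain t where "t^2 = \<delta>^2 / sq_dist A y"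
    using nth_root_exists[of 2 "\<delta>^2 / sq_dist A y"] by auto
  then show ?thesis
    using assms that[of t] by simp
qed

text \<open>At non-isotropic \<open>y\<close> the power of \<open>sq_dist A y\<close> in
  \<open>polyfun2_shift\<close> can be cancelled when only vanishing matters.\<close>

lemma polyfun2_shift_zero_iff:
  fixes A :: "'a::field \<times> 'a"
  assumes "polyfun2 f"
  obtains E F where "polyfun2 E" "polyfun2 F"
    "\<And>y t. sq_dist A y \<noteq> 0 \<Longrightarrow> t^2 * sq_dist A y = \<delta>^2 \<Longrightarrow> f (shift A t y) = 0 \<longleftrightarrow> E y + t * F y = 0"
proof -
  obtain k E F where *: "polyfun2 E" "polyfun2 F"
    and f: "\<And>y t. t^2 * sq_dist A y = \<delta>^2 \<Longrightarrow> sq_dist A y ^ k * f (shift A t y) = E y + t * F y"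
    using polyfun2_shift[OF assms, of A \<delta>] by blast
  show ?thesis
  proof (rule that[OF *])
    fix y t
    assume "sq_dist A y \<noteq> 0" "t^2 * sq_dist A y = \<delta>^2"
    then show "f (shift A t y) = 0 \<longleftrightarrow> E y + t * F y = 0"
      using f[of t y] by (metis mult_eq_0_iff power_not_zero)
  qed
qed

text \<open>The relation between a point and its conchoid points is symmetric as long as both are
  non-isotropic; non-isotropy of the image guarantees \<open>1 + s \<noteq> 0\<close>.\<close>

lemma shift_swap:
  fixes A :: "'a::field \<times> 'a"
  assumes "sq_dist A (shift A s Q) \<noteq> 0" "s^2 * sq_dist A Q = \<delta>^2"
  obtains t where "t = - s / (1 + s)" "Q = shift A t (shift A s Q)" "t^2 * sq_dist A (shift A s Q) = \<delta>^2"
proof -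
  have "1 + s \<noteq> 0"
    using assms(1) by (auto simp: sq_dist_shift)
  then have "(- s / (1 + s))^2 * sq_dist A (shift A s Q) = \<delta>^2"
    using assms(2) by (simp add: sq_dist_shift power_divide)
  then show ?thesis
    using that shift_inverse[OF \<open>1 + s \<noteq> 0\<close>, of A Q] by simp
qed

text \<open>By symmetry each point of the fibre is \<open>shift A t' Q\<close> with
  \<open>t'^2 = s^2\<close>. The intersection remains because a candidate may miss \<open>C\<close>
  or be isotropic.\<close>

lemma fibre_points_shift:
  fixes A :: "'a::field \<times> 'a"
  assumes Q: "sq_dist A Q \<noteq> 0" and s: "s^2 * sq_dist A Q = d^2"
  shows "fibre_points C A d Q = {shift A s Q, shift A (- s) Q} \<inter> {y \<in> C. sq_dist A y \<noteq> 0}"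
proof (intro equalityI subsetI)
  fix y assume "y \<in> fibre_points C A d Q"
  then obtain t where y: "y \<in> C" "sq_dist A y \<noteq> 0" and t: "t^2 * sq_dist A y = d^2" "Q = shift A t y"
    unfolding fibre_points_eq by blast
  obtain t' where t': "y = shift A t' Q" "t'^2 * sq_dist A Q = d^2"
    using shift_swap[of A t y d] Q t by metis
  have "t'^2 = s^2"
    using t'(2) s Q by (metis mult_right_cancel)
  then show "y \<in> {shift A s Q, shift A (- s) Q} \<inter> {y \<in> C. sq_dist A y \<noteq> 0}"
    using y t'(1) by (auto simp: power2_eq_iff)
next
  fix y assume "y \<in> {shift A s Q, shift A (- s) Q} \<inter> {y \<in> C. sq_dist A y \<noteq> 0}"
  then obtain r where r: "r = s \<or> r = - s" "y = shift A r Q" and y: "y \<in> C" "sq_dist A y \<noteq> 0"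
    by blast
  have "r^2 * sq_dist A Q = d^2"
    using r(1) s by auto
  then show "y \<in> fibre_points C A d Q"
    using shift_swap[of A r Q d] y unfolding fibre_points_eq r(2) by blast
qed

section \<open>The components of a conchoid\<close>

text \<open>The assumptions have the form that density arguments need: \<open>not_circle\<close>
  denies inclusion of \<open>C\<close> in a circle rather than equality. It is applied to the radii
  \<open>d\<close> and \<open>2 * d\<close>.\<close>

locale conchoid_base =
  fixes C :: "('a :: {alg_closed_field, field_char_0} \<times> 'a) set" and A :: "'a \<times> 'a" and d :: 'a
  assumes irred: "zariski_irreducible2 C"
    and closed: "zariski_closed2 C"
    and d_nonzero: "d \<noteq> 0"
    and not_isotropic: "\<exists>y\<in>C. sq_dist A y \<noteq> 0"
    and not_circle: "r \<noteq> 0 \<Longrightarrow> \<exists>y\<in>C. sq_dist A y \<noteq> r^2"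
begin

section \<open>Density on the curve and dominance of the components\<close>

lemma ex_generic:
  assumes "polyfun2 q" "\<exists>y\<in>C. q y \<noteq> 0"
  shows "\<exists>y\<in>C. sq_dist A y * q y \<noteq> 0"
  using zariski_irreducible2_ex_nonzero[OF irred polyfun2_sq_dist assms(1) not_isotropic assms(2)] .

lemma zeroI:
  assumes "polyfun2 q" "polyfun2 f" "\<exists>y\<in>C. q y \<noteq> 0"
    and "\<And>y. y \<in> C \<Longrightarrow> sq_dist A y \<noteq> 0 \<Longrightarrow> q y \<noteq> 0 \<Longrightarrow> f y = 0" and "y \<in> C"
  shows "f y = 0"
proof (rule zariski_irreducible2_zeroD[OF irred _ assms(2) ex_generic[OF assms(1,3)] _ assms(5)])
  show "polyfun2 (\<lambda>y. sq_dist A y * q y)"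
    using assms(1) by auto
qed (use assms(4) in auto)

text \<open>Since \<open>t\<close> and \<open>- t\<close> are admissible together, a polynomial vanishes at all points over \<open>y\<close>
  iff both its coefficients with respect to \<open>t\<close> vanish at \<open>y\<close>, which is a closed condition.\<close>
lemma vanishes_on_conchoid_points:
  assumes q: "polyfun2 q" "\<exists>y\<in>C. q y \<noteq> 0" and f: "polyfun2 f"
    and zero: "\<And>y t. y \<in> C \<Longrightarrow> sq_dist A y \<noteq> 0 \<Longrightarrow> q y \<noteq> 0 \<Longrightarrow> t^2 * sq_dist A y = d^2 \<Longrightarrow>
      f (shift A t y) = 0"
    and x: "x \<in> conchoid_points C A d"
  shows "f x = 0"
proof -
  obtain E F where EF: "polyfun2 E" "polyfun2 F"
    and f_iff: "\<And>y t. sq_dist A y \<noteq> 0 \<Longrightarrow> t^2 * sq_dist A y = d^2 \<Longrightarrow>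
      f (shift A t y) = 0 \<longleftrightarrow> E y + t * F y = 0"
    using polyfun2_shift_zero_iff[OF f, of A d] by blast
  have both: "E y = 0 \<and> F y = 0" if y: "y \<in> C" "sq_dist A y \<noteq> 0" "q y \<noteq> 0" for y
  proof -
    obtain t where t: "t^2 * sq_dist A y = d^2"
      using ex_shift_parameter[OF y(2)] .
    have "t \<noteq> 0"
      using t d_nonzero by auto
    have "E y + t * F y = 0" "E y + (- t) * F y = 0"
      using f_iff[OF y(2)] zero[OF y] t by (metis power2_minus)+
    then have "2 * E y = 0" "2 * (t * F y) = 0"
      by algebra+
    then show ?thesis
      using \<open>t \<noteq> 0\<close> by simp
  qed
  have "E y = 0" "F y = 0" if "y \<in> C" for y
    using zeroI[OF q(1) EF(1) q(2) _ that] zeroI[OF q(1) EF(2) q(2) _ that] both by blast+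
  then show ?thesis
    using x f_iff unfolding conchoid_points_def by force
qed

text \<open>Two facts about a component are collected here: it is the closure of genuine conchoid
  points rather than limit points, and it contains a conchoid point over each generic point of
  \<open>C\<close>.\<close>

definition dominant :: "('a \<times> 'a) set \<Rightarrow> bool" where
  "dominant M \<longleftrightarrow> M \<subseteq> zariski_closure2 (M \<inter> conchoid_points C A d) \<and>
     (\<exists>q. polyfun2 q \<and> (\<exists>y\<in>C. q y \<noteq> 0) \<and>
       (\<forall>y\<in>C. sq_dist A y \<noteq> 0 \<longrightarrow> q y \<noteq> 0 \<longrightarrow> (\<exists>t. t^2 * sq_dist A y = d^2 \<and> shift A t y \<in> M)))"

lemma dominant_closureI:
  assumes "X \<subseteq> conchoid_points C A d" "polyfun2 q" "\<exists>y\<in>C. q y \<noteq> 0"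
    and "\<And>y. y \<in> C \<Longrightarrow> sq_dist A y \<noteq> 0 \<Longrightarrow> q y \<noteq> 0 \<Longrightarrow> \<exists>t. t^2 * sq_dist A y = d^2 \<and> shift A t y \<in> X"
  shows "dominant (zariski_closure2 X)"
proof -
  have "zariski_closure2 X \<subseteq> zariski_closure2 (zariski_closure2 X \<inter> conchoid_points C A d)"
    using assms(1) zariski_closure2_superset by (intro zariski_closure2_mono) blast
  moreover have "\<exists>t. t^2 * sq_dist A y = d^2 \<and> shift A t y \<in> zariski_closure2 X"
    if "y \<in> C" "sq_dist A y \<noteq> 0" "q y \<noteq> 0" for y
    using assms(4)[OF that] zariski_closure2_superset[of X] by (meson subsetD)
  ultimately show ?thesis
    unfolding dominant_def using assms(2,3) by (intro conjI exI[of _ q]) simp_all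
qed

text \<open>The image of \<open>C\<close> under the rational map with parameter
  \<open>t = E / F\<close>, a square root of \<open>d^2 / sq_dist A y\<close> on \<open>C\<close> in
  all uses below.\<close>

definition branch :: "('a \<times> 'a \<Rightarrow> 'a) \<Rightarrow> ('a \<times> 'a \<Rightarrow> 'a) \<Rightarrow> ('a \<times> 'a) set" where
  "branch E F = {shift A (E y / F y) y | y. y \<in> C \<and> sq_dist A y \<noteq> 0 \<and> F y \<noteq> 0}"

lemma branch_parameter:
  assumes "\<And>y. y \<in> C \<Longrightarrow> sq_dist A y * E y ^ 2 = d^2 * F y ^ 2" "y \<in> C" "F y \<noteq> 0"
  shows "(E y / F y)^2 * sq_dist A y = d^2"
  using assms(1)[OF assms(2)] assms(3) by (simp add: power_divide field_simps)

lemma branch_subset: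
  assumes "\<And>y. y \<in> C \<Longrightarrow> sq_dist A y * E y ^ 2 = d^2 * F y ^ 2"
  shows "branch E F \<subseteq> conchoid_points C A d"
  using branch_parameter[OF assms] unfolding branch_def conchoid_points_def by blast

text \<open>A rational image of an irreducible set is irreducible: vanishing of \<open>f\<close> at
  the image of \<open>y\<close> is a polynomial condition \<open>p y = 0\<close>, so a product
  vanishing on the branch gives a product vanishing on \<open>C\<close>.\<close>

lemma branch_irreducible:
  assumes E: "polyfun2 E" and F: "polyfun2 F" "\<exists>y\<in>C. F y \<noteq> 0"
    and rel: "\<And>y. y \<in> C \<Longrightarrow> sq_dist A y * E y ^ 2 = d^2 * F y ^ 2"
  shows "zariski_irreducible2 (branch E F)"
proof -
  have pull: "\<exists>p. polyfun2 p \<and> (\<forall>y\<in>C. sq_dist A y \<noteq> 0 \<longrightarrow> F y \<noteq> 0 \<longrightarrow>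
      (f (shift A (E y / F y) y) = 0 \<longleftrightarrow> p y = 0))" if f: "polyfun2 f" for f
  proof -
    obtain G H where GH: "polyfun2 G" "polyfun2 H"
      and f_iff: "\<And>y t. sq_dist A y \<noteq> 0 \<Longrightarrow> t^2 * sq_dist A y = d^2 \<Longrightarrow>
        f (shift A t y) = 0 \<longleftrightarrow> G y + t * H y = 0"
      using polyfun2_shift_zero_iff[OF f, of A d] by blast
    have "f (shift A (E y / F y) y) = 0 \<longleftrightarrow> F y * G y + E y * H y = 0"
      if y: "y \<in> C" "sq_dist A y \<noteq> 0" "F y \<noteq> 0" for y
    proof -
      have "F y * G y + E y * H y = F y * (G y + E y / F y * H y)"
        using y(3) by (simp add: field_simps)
      then show ?thesis
        using f_iff[OF y(2) branch_parameter[OF rel y(1,3)]] y(3) by simp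
    qed
    moreover have "polyfun2 (\<lambda>y. F y * G y + E y * H y)"
      using E F GH by (intro polyfun2_add polyfun2_mult)
    ultimately show ?thesis
      by blast
  qed
  obtain y0 where "y0 \<in> C" "sq_dist A y0 \<noteq> 0" "F y0 \<noteq> 0"
    using ex_generic[OF F] by auto
  then have "branch E F \<noteq> {}"
    unfolding branch_def by blast
  moreover have "(\<forall>x\<in>branch E F. f x = 0) \<or> (\<forall>x\<in>branch E F. h x = 0)"
    if fh: "polyfun2 f" "polyfun2 h" "\<forall>x\<in>branch E F. f x * h x = 0" for f h
  proof -
    obtain p where p: "polyfun2 p" "\<And>y. y \<in> C \<Longrightarrow> sq_dist A y \<noteq> 0 \<Longrightarrow> F y \<noteq> 0 \<Longrightarrow>
        f (shift A (E y / F y) y) = 0 \<longleftrightarrow> p y = 0"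
      using pull[OF fh(1)] by blast
    obtain q where q: "polyfun2 q" "\<And>y. y \<in> C \<Longrightarrow> sq_dist A y \<noteq> 0 \<Longrightarrow> F y \<noteq> 0 \<Longrightarrow>
        h (shift A (E y / F y) y) = 0 \<longleftrightarrow> q y = 0"
      using pull[OF fh(2)] by blast
    have "p y * q y = 0" if "y \<in> C" for y
    proof (rule zeroI[OF F(1) _ F(2) _ that])
      show "polyfun2 (\<lambda>y. p y * q y)"
        using p(1) q(1) by auto
      fix y
      assume y: "y \<in> C" "sq_dist A y \<noteq> 0" "F y \<noteq> 0"
      then have "shift A (E y / F y) y \<in> branch E F"
        unfolding branch_def by blast
      then show "p y * q y = 0"
        using fh(3) p(2)[OF y] q(2)[OF y] by auto
    qed
    then have "(\<forall>y\<in>C. p y = 0) \<or> (\<forall>y\<in>C. q y = 0)"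
      using irred p(1) q(1) unfolding zariski_irreducible2_iff by blast
    then show ?thesis
      using p(2) q(2) unfolding branch_def by blast
  qed
  ultimately show ?thesis
    unfolding zariski_irreducible2_iff by blast
qed

text \<open>If \<open>E / F\<close> is a square root of \<open>d^2 / sq_dist A y\<close> on
  \<open>C\<close>, the closures of the branches for \<open>E / F\<close> and \<open>- E / F\<close>
  cover the conchoid. The irreducible \<open>M\<close> lies in one of them and equals it by
  maximality.\<close>

lemma component_dominant_split:
  assumes M: "irreducible_component2 M (conchoid C A d)"
    and E: "polyfun2 E" and F: "polyfun2 F" "\<exists>y\<in>C. F y \<noteq> 0"
    and rel: "\<And>y. y \<in> C \<Longrightarrow> sq_dist A y * E y ^ 2 = d^2 * F y ^ 2"
  shows "dominant M"
proof -
  let ?E' = "\<lambda>y. - E y"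
  have E': "polyfun2 ?E'"
    using polyfun2_mult[OF polyfun2_const E, of "-1"] by simp
  have rel': "\<And>y. y \<in> C \<Longrightarrow> sq_dist A y * ?E' y ^ 2 = d^2 * F y ^ 2"
    using rel by simp
  have "conchoid C A d \<subseteq> zariski_closure2 (branch E F) \<union> zariski_closure2 (branch ?E' F)"
  proof (rule ccontr)
    assume "\<not> ?thesis"
    then obtain x where x: "x \<in> conchoid C A d" "x \<notin> zariski_closure2 (branch E F)"
        "x \<notin> zariski_closure2 (branch ?E' F)"
      by blast
    obtain f where f: "polyfun2 f" "\<forall>z\<in>branch E F. f z = 0" "f x \<noteq> 0"
      using x(2) unfolding zariski_closure2_iff by blast
    obtain h where h: "polyfun2 h" "\<forall>z\<in>branch ?E' F. h z = 0" "h x \<noteq> 0"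
      using x(3) unfolding zariski_closure2_iff by blast
    have fh: "polyfun2 (\<lambda>x. f x * h x)"
      using f(1) h(1) by auto
    have "f z * h z = 0" if "z \<in> conchoid_points C A d" for z
    proof (rule vanishes_on_conchoid_points[OF F fh _ that])
      fix y t
      assume y: "y \<in> C" "sq_dist A y \<noteq> 0" "F y \<noteq> 0" and t: "t^2 * sq_dist A y = d^2"
      have "sq_dist A y * (E y)^2 = sq_dist A y * (t * F y)^2"
        using rel[OF y(1)] t by (simp add: power_mult_distrib algebra_simps)
      then have "(t * F y)^2 = (E y)^2"
        using y(2) by simp
      then have "t * F y = E y \<or> t * F y = ?E' y"
        by (simp only: power2_eq_iff)
      then have "t = E y / F y \<or> t = ?E' y / F y"
        using y(3) eq_divide_imp[of "F y" t "E y"] eq_divide_imp[of "F y" t "?E' y"] by blast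
      then have "shift A t y \<in> branch E F \<or> shift A t y \<in> branch ?E' F"
        using y unfolding branch_def by blast
      then show "f (shift A t y) * h (shift A t y) = 0"
        using f(2) h(2) by auto
    qed
    then have "f x * h x = 0"
      using zariski_closure2D[OF x(1)[unfolded conchoid_eq] fh] by simp
    then show False
      using f(3) h(3) by simp
  qed
  moreover have "M \<subseteq> conchoid C A d" "zariski_irreducible2 M"
    using M by (simp_all add: irreducible_component2_def)
  ultimately have "M \<subseteq> zariski_closure2 (branch E F) \<union> zariski_closure2 (branch ?E' F)"
    by (meson order_trans)
  then have sub: "M \<subseteq> zariski_closure2 (branch E F) \<or> M \<subseteq> zariski_closure2 (branch ?E' F)"
    using zariski_irreducible2D[OF \<open>zariski_irreducible2 M\<close> zariski_closed2_closure zariski_closed2_closure] by simp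
  have dom: "dominant M" if G: "polyfun2 G" "\<And>y. y \<in> C \<Longrightarrow> sq_dist A y * G y ^ 2 = d^2 * F y ^ 2"
    "M \<subseteq> zariski_closure2 (branch G F)" for G
  proof -
    have "M = zariski_closure2 (branch G F)"
    proof (rule irreducible_component2_eq[OF M _ _ _ G(3)])
      show "zariski_irreducible2 (zariski_closure2 (branch G F))"
        using branch_irreducible[OF G(1) F G(2)] by (rule zariski_irreducible2_closure)
      show "zariski_closure2 (branch G F) \<subseteq> conchoid C A d"
        unfolding conchoid_eq by (intro zariski_closure2_mono branch_subset G(2))
    qed (rule zariski_closed2_closure)
    moreover have "dominant (zariski_closure2 (branch G F))"
    proof (rule dominant_closureI[OF branch_subset[OF G(2)] F])
      fix y
      assume y: "y \<in> C" "sq_dist A y \<noteq> 0" "F y \<noteq> 0"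
      then have "shift A (G y / F y) y \<in> branch G F"
        unfolding branch_def by blast
      then show "\<exists>t. t^2 * sq_dist A y = d^2 \<and> shift A t y \<in> branch G F"
        using branch_parameter[OF G(2) y(1,3)] by blast
    qed
    ultimately show ?thesis
      by simp
  qed
  show ?thesis
    using sub
  proof (elim disjE)
    assume "M \<subseteq> zariski_closure2 (branch E F)"
    then show ?thesis
      using E rel by (intro dom)
  next
    assume "M \<subseteq> zariski_closure2 (branch ?E' F)"
    then show ?thesis
      using E' rel' by (intro dom)
  qed
qed

text \<open>Either the conchoid points form an irreducible set and \<open>M\<close> is the whole
  conchoid, or zero divisors \<open>f\<close> and \<open>h\<close> on them provide a square root of
  \<open>d^2 / sq_dist A y\<close>.\<close>

lemma component_dominant:
  assumes M: "irreducible_component2 M (conchoid C A d)"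
  shows "dominant M"
proof (cases "zariski_irreducible2 (conchoid_points C A d)")
  case True
  have "zariski_irreducible2 (conchoid C A d)"
    unfolding conchoid_eq using True by (rule zariski_irreducible2_closure)
  moreover have "M \<subseteq> conchoid C A d"
    using M unfolding irreducible_component2_def by blast
  moreover have "zariski_closed2 (conchoid C A d)"
    unfolding conchoid_eq by (rule zariski_closed2_closure)
  ultimately have "M = conchoid C A d"
    using irreducible_component2_eq[OF M] by blast
  moreover have "dominant (conchoid C A d)"
    unfolding conchoid_eq
  proof (rule dominant_closureI)
    show "polyfun2 (\<lambda>y. 1)"
      by (rule polyfun2_const)
    show "\<exists>y\<in>C. (1 :: 'a) \<noteq> 0"
      using not_isotropic by auto
    fix y
    assume y: "y \<in> C" "sq_dist A y \<noteq> 0"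
    obtain t where "t^2 * sq_dist A y = d^2"
      using ex_shift_parameter[OF y(2)] .
    then show "\<exists>t. t^2 * sq_dist A y = d^2 \<and> shift A t y \<in> conchoid_points C A d"
      using y unfolding conchoid_points_def by blast
  qed simp
  ultimately show ?thesis
    by simp
next
  case False
  obtain y0 where y0: "y0 \<in> C" "sq_dist A y0 \<noteq> 0"
    using not_isotropic by blast
  obtain t0 where "t0^2 * sq_dist A y0 = d^2"
    using ex_shift_parameter[OF y0(2)] .
  then have "conchoid_points C A d \<noteq> {}"
    using y0 unfolding conchoid_points_def by blast
  then obtain f h where fh: "polyfun2 f" "polyfun2 h"
      "\<forall>x\<in>conchoid_points C A d. f x * h x = 0"
      "\<exists>x\<in>conchoid_points C A d. f x \<noteq> 0" "\<exists>x\<in>conchoid_points C A d. h x \<noteq> 0"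
    using False unfolding zariski_irreducible2_iff by blast
  obtain E F where EF: "polyfun2 E" "polyfun2 F"
    and f_iff: "\<And>y t. sq_dist A y \<noteq> 0 \<Longrightarrow> t^2 * sq_dist A y = d^2 \<Longrightarrow>
      f (shift A t y) = 0 \<longleftrightarrow> E y + t * F y = 0"
    using polyfun2_shift_zero_iff[OF fh(1), of A d] by blast
  obtain G H where GH: "polyfun2 G" "polyfun2 H"
    and h_iff: "\<And>y t. sq_dist A y \<noteq> 0 \<Longrightarrow> t^2 * sq_dist A y = d^2 \<Longrightarrow>
      h (shift A t y) = 0 \<longleftrightarrow> G y + t * H y = 0"
    using polyfun2_shift_zero_iff[OF fh(2), of A d] by blast
  text \<open>The norms of \<open>E + t * F\<close> and \<open>G + t * H\<close> over the coordinate ring of \<open>C\<close>.\<close>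
  define m where "m y = sq_dist A y * E y ^ 2 - d^2 * F y ^ 2" for y
  define n where "n y = sq_dist A y * G y ^ 2 - d^2 * H y ^ 2" for y
  have mn: "polyfun2 m" "polyfun2 n"
    unfolding m_def[abs_def] n_def[abs_def] using EF GH
    by - (intro polyfun2_diff polyfun2_mult polyfun2_power polyfun2_sq_dist polyfun2_const; assumption)+
  have "m y * n y = 0" if "y \<in> C" for y
  proof (rule zeroI[where q = "\<lambda>y. 1", OF _ _ _ _ that])
    show "polyfun2 (\<lambda>y. 1)" "\<exists>y\<in>C. (1 :: 'a) \<noteq> 0" "polyfun2 (\<lambda>y. m y * n y)"
      using not_isotropic mn by auto
    fix y
    assume y: "y \<in> C" "sq_dist A y \<noteq> 0"
    obtain t where t: "t^2 * sq_dist A y = d^2"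
      using ex_shift_parameter[OF y(2)] .
    have zero: "(E y + s * F y) * (G y + s * H y) = 0" if "s^2 * sq_dist A y = d^2" for s
    proof -
      have "shift A s y \<in> conchoid_points C A d"
        using y that unfolding conchoid_points_def by blast
      then show ?thesis
        using fh(3) f_iff[OF y(2) that] h_iff[OF y(2) that] by auto
    qed
    \<comment> \<open>Each norm is a product over the parameters \<open>t\<close> and
      \<open>- t\<close>, and at each of them a factor of \<open>m\<close> or of \<open>n\<close>
      vanishes.\<close>
    have "m y = sq_dist A y * ((E y + t * F y) * (E y + (- t) * F y))"
        "n y = sq_dist A y * ((G y + t * H y) * (G y + (- t) * H y))"
      unfolding m_def n_def t[symmetric] by (simp_all add: algebra_simps power2_eq_square)
    then show "m y * n y = 0"
      using zero[OF t] zero[of "- t"] t by auto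
  qed
  then have disj: "(\<forall>y\<in>C. m y = 0) \<or> (\<forall>y\<in>C. n y = 0)"
    using irred mn unfolding zariski_irreducible2_iff by blast
  have dom: "dominant M" if k: "\<exists>x\<in>conchoid_points C A d. k x \<noteq> 0"
    and UV: "polyfun2 U" "polyfun2 V" "\<forall>y\<in>C. sq_dist A y * U y ^ 2 - d^2 * V y ^ 2 = 0"
    and k_iff: "\<And>y t. sq_dist A y \<noteq> 0 \<Longrightarrow> t^2 * sq_dist A y = d^2 \<Longrightarrow>
      k (shift A t y) = 0 \<longleftrightarrow> U y + t * V y = 0" for k :: "'a \<times> 'a \<Rightarrow> 'a" and U V
  proof -
    obtain y t where y: "y \<in> C" "sq_dist A y \<noteq> 0" "t^2 * sq_dist A y = d^2" "k (shift A t y) \<noteq> 0"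
      using k unfolding conchoid_points_def by blast
    \<comment> \<open>The denominator is not identically zero on \<open>C\<close>: with norm zero,
      \<open>V y = 0\<close> would force \<open>U y = 0\<close> and hence \<open>k\<close> to vanish
      at this conchoid point.\<close>
    have "V y \<noteq> 0"
    proof
      assume "V y = 0"
      then have "U y = 0"
        using UV(3) y(1,2) by fastforce
      then show False
        using \<open>V y = 0\<close> k_iff[OF y(2,3)] y(4) by simp
    qed
    then show ?thesis
      using component_dominant_split[OF M UV(1,2)] UV(3) y(1) by (metis eq_iff_diff_eq_0)
  qed
  show ?thesis
    using disj dom[OF fh(4) EF _ f_iff] dom[OF fh(5) GH _ h_iff] unfolding m_def n_def by blast
qed

section \<open>Comparing the curve with the conchoid of a component\<close>

lemma dominant_ex_generic:
  assumes "dominant M"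
  shows "\<exists>Q\<in>M. sq_dist A Q \<noteq> 0 \<and> sq_dist A Q \<noteq> d^2"
proof -
  obtain q where q: "polyfun2 q" "\<exists>y\<in>C. q y \<noteq> 0"
    and lift: "\<And>y. y \<in> C \<Longrightarrow> sq_dist A y \<noteq> 0 \<Longrightarrow> q y \<noteq> 0 \<Longrightarrow>
      \<exists>t. t^2 * sq_dist A y = d^2 \<and> shift A t y \<in> M"
    using assms unfolding dominant_def by blast
  define c where "c r y = sq_dist A y - r^2" for r y
  have c: "polyfun2 (c r)" for r
    unfolding c_def[abs_def] by (intro polyfun2_diff) auto
  \<comment> \<open>For \<open>Q = shift A t y\<close> the exceptional value
    \<open>sq_dist A Q = 0\<close> means \<open>t = -1\<close>, so \<open>y\<close> is on the circle
    of radius \<open>d\<close>; \<open>sq_dist A Q = d^2\<close> means \<open>2 * t = -1\<close>, so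
    \<open>y\<close> is on the circle of radius \<open>2 * d\<close>.\<close>
  have "\<exists>y\<in>C. c d y \<noteq> 0" "\<exists>y\<in>C. c (2 * d) y \<noteq> 0"
    using not_circle[of d] not_circle[of "2 * d"] d_nonzero by (auto simp: c_def)
  then have "\<exists>y\<in>C. c d y * c (2 * d) y \<noteq> 0"
    by (rule zariski_irreducible2_ex_nonzero[OF irred c c])
  then have "\<exists>y\<in>C. q y * (c d y * c (2 * d) y) \<noteq> 0"
    using c by (intro zariski_irreducible2_ex_nonzero[OF irred q(1) _ q(2)]) auto
  then have "\<exists>y\<in>C. sq_dist A y * (q y * (c d y * c (2 * d) y)) \<noteq> 0"
    by (intro ex_generic polyfun2_mult q(1) c)
  then obtain y where "y \<in> C" "sq_dist A y * (q y * (c d y * c (2 * d) y)) \<noteq> 0"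
    by blast
  then have y: "y \<in> C" "sq_dist A y \<noteq> 0" "q y \<noteq> 0" "c d y \<noteq> 0" "c (2 * d) y \<noteq> 0"
    by simp_all
  obtain t where t: "t^2 * sq_dist A y = d^2" "shift A t y \<in> M"
    using lift[OF y(1-3)] by blast
  have "1 + t \<noteq> 0"
  proof
    assume "1 + t = 0"
    then have "t = -1"
      by (simp add: add_eq_0_iff)
    then show False
      using t(1) y(4) by (simp add: c_def)
  qed
  moreover have "(1 + t)^2 * sq_dist A y \<noteq> d^2"
  proof
    assume "(1 + t)^2 * sq_dist A y = d^2"
    then have "(1 + t)^2 = t^2"
      using t(1) y(2) by (metis mult_right_cancel)
    then have "2 * t = -1"
      by (simp add: power2_eq_square algebra_simps add_eq_0_iff)
    have "(2 * d)^2 = (2 * t)^2 * sq_dist A y"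
      using t(1) by (simp add: power_mult_distrib)
    then show False
      using y(5) by (simp add: \<open>2 * t = -1\<close> c_def)
  qed
  ultimately show ?thesis
    using t(2) y(2) by (intro bexI[of _ "shift A t y"]) (simp_all add: sq_dist_shift)
qed

text \<open>Over \<open>Q\<close> in \<open>M\<close> with \<open>sq_dist A Q\<close> different from
  \<open>0\<close> and \<open>d^2\<close>, both candidates lie on \<open>C\<close>, are
  non-isotropic and are distinct, so the fibre has two points. A set witnessing simplicity would
  avoid all such \<open>Q\<close>, and by density so would \<open>M\<close>.\<close>

lemma conchoid_special:
  assumes M: "dominant M" "conchoid M A d = C"
  shows "special_component C A d M"
  unfolding special_component_def
proof
  assume "simple_component C A d M"
  then obtain \<Omega> where \<Omega>: "M \<subseteq> zariski_closure2 \<Omega>" "\<Omega> \<subseteq> M"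
      "\<And>Q. Q \<in> \<Omega> \<Longrightarrow> card (fibre_points C A d Q) = 1"
    unfolding simple_component_def by blast
  have zero: "sq_dist A Q * (sq_dist A Q - d^2) = 0" if "Q \<in> \<Omega>" for Q
  proof (rule ccontr)
    assume "\<not> ?thesis"
    then have Q: "sq_dist A Q \<noteq> 0" "sq_dist A Q \<noteq> d^2"
      by auto
    obtain s where s: "s^2 * sq_dist A Q = d^2"
      using ex_shift_parameter[OF Q(1)] .
    have "shift A r Q \<in> C \<and> sq_dist A (shift A r Q) \<noteq> 0" if r: "r^2 * sq_dist A Q = d^2" for r
    proof
      have "shift A r Q \<in> conchoid_points M A d"
        using \<Omega>(2) \<open>Q \<in> \<Omega>\<close> Q r unfolding conchoid_points_def by blast
      then show "shift A r Q \<in> C"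
        using M(2) zariski_closure2_superset unfolding conchoid_eq by blast
      have "1 + r \<noteq> 0"
      proof
        assume "1 + r = 0"
        then have "r = -1"
          by (simp add: add_eq_0_iff)
        then show False
          using r Q by simp
      qed
      then show "sq_dist A (shift A r Q) \<noteq> 0"
        using Q by (simp add: sq_dist_shift)
    qed
    from this[of s] this[of "- s"]
    have "fibre_points C A d Q = {shift A s Q, shift A (- s) Q}"
      unfolding fibre_points_shift[OF Q(1) s] using s by auto
    moreover have "shift A s Q \<noteq> shift A (- s) Q"
    proof
      assume "shift A s Q = shift A (- s) Q"
      then have "s = - s"
        using shift_inj Q(1) by blast
      then show False
        using s d_nonzero by auto
    qed
    ultimately show False
      using \<Omega>(3)[OF that] by simp
  qed
  have "polyfun2 (\<lambda>Q. sq_dist A Q * (sq_dist A Q - d^2))"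
    by (intro polyfun2_mult polyfun2_diff) auto
  then have "sq_dist A Q * (sq_dist A Q - d^2) = 0" if "Q \<in> M" for Q
    using zariski_closure2D[OF subsetD[OF \<Omega>(1) that] _ zero] by simp
  then show False
    using dominant_ex_generic[OF M(1)] by auto
qed

text \<open>A generic \<open>y\<close> in \<open>C\<close> has a conchoid point in \<open>M\<close>,
  and \<open>shift_swap\<close> leads from it back to \<open>y\<close>. Density extends this to all
  of \<open>C\<close>.\<close>

lemma subset_conchoid:
  assumes M: "dominant M"
  shows "C \<subseteq> conchoid M A d"
proof
  fix y assume "y \<in> C"
  obtain q where q: "polyfun2 q" "\<exists>y\<in>C. q y \<noteq> 0"
    and lift: "\<And>y. y \<in> C \<Longrightarrow> sq_dist A y \<noteq> 0 \<Longrightarrow> q y \<noteq> 0 \<Longrightarrow>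
      \<exists>t. t^2 * sq_dist A y = d^2 \<and> shift A t y \<in> M"
    using M unfolding dominant_def by blast
  \<comment> \<open>Excludes the parameter \<open>t = -1\<close>, for which the conchoid point is
    \<open>A\<close> itself and cannot be reversed.\<close>
  have c: "polyfun2 (\<lambda>y. sq_dist A y - d^2)"
    by (intro polyfun2_diff) auto
  then have qc: "polyfun2 (\<lambda>y. q y * (sq_dist A y - d^2))"
    using q(1) by auto
  have nz: "\<exists>y\<in>C. q y * (sq_dist A y - d^2) \<noteq> 0"
    using not_circle[OF d_nonzero] by (intro zariski_irreducible2_ex_nonzero[OF irred q(1) c q(2)]) auto
  show "y \<in> conchoid M A d"
    unfolding conchoid_eq zariski_closure2_iff
  proof (intro allI impI)
    fix f :: "'a \<times> 'a \<Rightarrow> 'a"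
    assume f: "polyfun2 f" "\<forall>x\<in>conchoid_points M A d. f x = 0"
    show "f y = 0"
    proof (rule zeroI[OF qc f(1) nz _ \<open>y \<in> C\<close>])
      fix y
      assume y: "y \<in> C" "sq_dist A y \<noteq> 0" "q y * (sq_dist A y - d^2) \<noteq> 0"
      then obtain t where t: "t^2 * sq_dist A y = d^2" "shift A t y \<in> M"
        using lift[OF y(1,2)] by auto
      have "1 + t \<noteq> 0"
      proof
        assume "1 + t = 0"
        then have "t = -1"
          by (simp add: add_eq_0_iff)
        then show False
          using t(1) y(3) by simp
      qed
      then have Q: "sq_dist A (shift A t y) \<noteq> 0"
        using y(2) by (simp add: sq_dist_shift)
      then have "y \<in> conchoid_points M A d"
        using shift_swap[OF Q t(1)] t(2) unfolding conchoid_points_def by blast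
      then show "f y = 0"
        using f(2) by blast
    qed
  qed
qed

text \<open>One candidate outside \<open>C\<close>, over a single point \<open>Q0\<close>, forces
  the same over a dense set of \<open>Q\<close> in \<open>M\<close>: at least one of the two
  candidates misses \<open>C\<close>. Over conchoid points the fibre is non-empty, so it has exactly
  one element and \<open>M\<close> is simple.\<close>

lemma special_conchoid:
  assumes M: "dominant M" "zariski_irreducible2 M" and special: "special_component C A d M"
  shows "conchoid M A d \<subseteq> C"
  unfolding conchoid_eq
proof (rule zariski_closure2_minimal[OF closed], rule ccontr)
  assume "\<not> conchoid_points M A d \<subseteq> C"
  then obtain Q0 s0 where Q0: "Q0 \<in> M" "sq_dist A Q0 \<noteq> 0" "s0^2 * sq_dist A Q0 = d^2" "shift A s0 Q0 \<notin> C"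
    unfolding conchoid_points_def by blast
  obtain f where f: "polyfun2 f" "\<forall>y\<in>C. f y = 0" "f (shift A s0 Q0) \<noteq> 0"
    using zariski_closed2_separate[OF closed Q0(4)] .
  obtain E F where EF: "polyfun2 E" "polyfun2 F"
    and f_iff: "\<And>Q s. sq_dist A Q \<noteq> 0 \<Longrightarrow> s^2 * sq_dist A Q = d^2 \<Longrightarrow>
      f (shift A s Q) = 0 \<longleftrightarrow> E Q + s * F Q = 0"
    using polyfun2_shift_zero_iff[OF f(1), of A d] by blast
  have "E Q0 \<noteq> 0 \<or> F Q0 \<noteq> 0"
    using f_iff[OF Q0(2,3)] f(3) by auto
  \<comment> \<open>\<open>e\<close> is whichever of \<open>E\<close> and \<open>F\<close> does not
    vanish at \<open>Q0\<close>. Where it is non-zero, \<open>f\<close> cannot vanish at both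
    candidates.\<close>
  then obtain e where e: "polyfun2 e" "e Q0 \<noteq> 0" "\<And>Q. E Q = 0 \<Longrightarrow> F Q = 0 \<Longrightarrow> e Q = 0"
    using EF by blast
  define \<Omega> where "\<Omega> = {Q \<in> M \<inter> conchoid_points C A d. sq_dist A Q * e Q \<noteq> 0}"
  have card: "card (fibre_points C A d Q) = 1" if "Q \<in> \<Omega>" for Q
  proof -
    have Q: "Q \<in> conchoid_points C A d" "sq_dist A Q \<noteq> 0" "e Q \<noteq> 0"
      using that unfolding \<Omega>_def by auto
    obtain s where s: "s^2 * sq_dist A Q = d^2"
      using ex_shift_parameter[OF Q(2)] .
    have "fibre_points C A d Q \<noteq> {}"
      using Q(1) unfolding fibre_points_eq conchoid_points_def by blast
    moreover have "\<not> {shift A s Q, shift A (- s) Q} \<subseteq> C"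
    proof
      assume "{shift A s Q, shift A (- s) Q} \<subseteq> C"
      then have "f (shift A s Q) = 0" "f (shift A (- s) Q) = 0"
        using f(2) by auto
      then have "E Q + s * F Q = 0" "E Q + (- s) * F Q = 0"
        using f_iff[OF Q(2), of s] f_iff[OF Q(2), of "- s"] s by auto
      then have "2 * E Q = 0" "2 * (s * F Q) = 0"
        by algebra+
      moreover have "s \<noteq> 0"
        using s d_nonzero by auto
      ultimately show False
        using e(3)[of Q] Q(3) by simp
    qed
    ultimately obtain y where "fibre_points C A d Q = {y}"
      unfolding fibre_points_shift[OF Q(2) s] by blast
    then show ?thesis
      by simp
  qed
  have Ne: "polyfun2 (\<lambda>Q. sq_dist A Q * e Q)"
    using e(1) by auto
  have dense: "M \<subseteq> zariski_closure2 \<Omega>"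
  proof
    fix Q assume "Q \<in> M"
    have "h Q = 0" if h: "polyfun2 h" "\<forall>x\<in>\<Omega>. h x = 0" for h
    proof (rule zariski_irreducible2_zeroD[OF M(2) Ne h(1) _ _ \<open>Q \<in> M\<close>])
      show "\<exists>y\<in>M. sq_dist A y * e y \<noteq> 0"
        using Q0(1,2) e(2) by auto
      have zero: "sq_dist A x * e x * h x = 0" if "x \<in> M \<inter> conchoid_points C A d" for x
      proof (cases "sq_dist A x * e x = 0")
        case False
        then have "x \<in> \<Omega>"
          using that unfolding \<Omega>_def by blast
        then show ?thesis
          using h(2) by simp
      qed simp
      \<comment> \<open>The conchoid points in \<open>M\<close> are dense, so the vanishing of the
        product extends to \<open>M\<close>; irreducibility of \<open>M\<close> then removes the
        factor \<open>sq_dist A y * e y\<close>.\<close>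
      have "M \<subseteq> zariski_closure2 (M \<inter> conchoid_points C A d)"
        using M(1) unfolding dominant_def by blast
      then have "sq_dist A x * e x * h x = 0" if "x \<in> M" for x
        using zariski_closure2D[OF subsetD[OF _ that] polyfun2_mult[OF Ne h(1)] zero] by blast
      then show "h y = 0" if "y \<in> M" "sq_dist A y * e y \<noteq> 0" for y
        using that by (metis mult_eq_0_iff)
    qed
    then show "Q \<in> zariski_closure2 \<Omega>"
      unfolding zariski_closure2_iff by blast
  qed
  have "\<Omega> \<noteq> {}"
  proof
    assume "\<Omega> = {}"
    then have "Q0 \<in> zariski_closure2 {}"
      using dense Q0(1) by blast
    then have "(1 :: 'a) = 0"
      by (rule zariski_closure2D[OF _ polyfun2_const]) simp
    then show False
      by simp
  qed
  moreover have "\<Omega> \<subseteq> M"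
    unfolding \<Omega>_def by blast
  ultimately have "simple_component C A d M"
    unfolding simple_component_def using dense card by (intro exI[of _ \<Omega>] conjI ballI)
  then show False
    using special unfolding special_component_def by blast
qed

end

theorem theorem2:
  fixes C :: "('a :: {alg_closed_field, field_char_0} \<times> 'a) set"
    and A :: "'a \<times> 'a" and d :: 'a and M :: "('a \<times> 'a) set"
  assumes "irreducible_plane_curve C"
    and "d \<noteq> 0"
    and "C0 C A \<noteq> {}"
    and "\<not> is_circle_centered C A"
    and "irreducible_component2 M (conchoid C A d)"
  shows "special_component C A d M \<longleftrightarrow> conchoid M A d = C"
proof -
  interpret conchoid_base C A d
  proof
    show "zariski_irreducible2 C" "zariski_closed2 C"
      using assms(1) irreducible_plane_curve_irreducible irreducible_plane_curve_closed by blast+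
    show "d \<noteq> 0"
      by fact
    show "\<exists>y\<in>C. sq_dist A y \<noteq> 0"
      using assms(3) unfolding C0_def sq_dist_def by blast
    \<comment> \<open>A plane curve contained in a circle of non-zero radius would be that
      circle.\<close>
    show "\<exists>y\<in>C. sq_dist A y \<noteq> r^2" if "r \<noteq> 0" for r
      using irreducible_plane_curve_eq_circle[OF assms(1) _ that, of A] assms(4)
      unfolding is_circle_centered_def sq_dist_def by blast
  qed
  have "dominant M" "zariski_irreducible2 M"
    using component_dominant[OF assms(5)] assms(5) by (simp_all add: irreducible_component2_def)
  then show ?thesis
    using conchoid_special special_conchoid subset_conchoid by blast
qed

end
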